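(* Let $n$ be a power of $3$. Then, for almost every triangle $T$ there is an $\varepsilon=\varepsilon(T)>0$ such that $$h(n,T,\varepsilon)=\frac1{24}(n^3-n).$$
   Context: Let $T,T'$ be triangles with angles $\alpha\le\beta\le\gamma$ and $\alpha'\le\beta'\le\gamma'$ respectively. For $\varepsilon>0$, the triangle $T'$ is $\varepsilon$-similar to $T$ if $|\alpha-\alpha'|<\varepsilon$, $|\beta-\beta'|<\varepsilon$ and $|\gamma-\gamma'|<\varepsilon$. For a triangle $T$, $\varepsilon>0$ and $n\in\mathbb{N}$, $h(n,T,\varepsilon)$ denotes the maximum, over all sets $P\subseteq\mathbb{R}^2$ of $n$ points, of the number of triangles with vertices in $P$ (i.e. 3-element subsets of $P$ forming a triangle) that are $\varepsilon$-similar to $T$. The space of triangle shapes is $S=\{(\alpha,\beta,\gamma)\in\mathbb{R}^3:\alpha,\beta,\gamma>0,\ \alpha+\beta+\gamma=\pi\}$, a triangle being represented by its triple of angles. A statement holds for almost every triangle if there is a set $S'\subseteq S$ of 2-dimensional Lebesgue measure $0$ such that the statement holds for all $T\in S\setminus S'$. *)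

theory Defs
  imports "HOL-Analysis.Analysis"
begin

definition triangle_shapes :: "(real \<times> real \<times> real) set" where
  "triangle_shapes =
     {(\<alpha>, \<beta>, \<gamma>). \<alpha> > 0 \<and> \<beta> > 0 \<and> \<gamma> > 0 \<and> \<alpha> + \<beta> + \<gamma> = pi}"

subsection \<open>Two-dimensional Lebesgue measure on the plane of triangle shapes\<close>

text \<open>
  An isometric parametrisation of the plane \<open>\<alpha> + \<beta> + \<gamma> = \<pi>\<close>: the origin is sent to the equilateral
  shape, and the coordinate axes to the orthonormal directions \<open>(1, -1, 0) / \<surd>2\<close> and
  \<open>(1, 1, -2) / \<surd>6\<close>.
\<close>

definition shape_chart :: "real \<times> real \<Rightarrow> real \<times> real \<times> real" where
  "shape_chart = (\<lambda>(u, v).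
     (pi / 3 + u / sqrt 2 + v / sqrt 6,
      pi / 3 - u / sqrt 2 + v / sqrt 6,
      pi / 3 - 2 * v / sqrt 6))"

lemma dist_shape_chart: "dist (shape_chart p) (shape_chart q) = dist p q"
proof -
  obtain u v where p: "p = (u, v)" by (cases p)
  obtain u' v' where q: "q = (u', v')" by (cases q)
  define x where "x = (u - u') / sqrt 2"
  define y where "y = (v - v') / sqrt 6"
  have x2: "2 * x\<^sup>2 = (u - u')\<^sup>2" and y2: "6 * y\<^sup>2 = (v - v')\<^sup>2"
    by (simp_all add: x_def y_def power_divide)
  have "(x + y)\<^sup>2 + ((y - x)\<^sup>2 + (- 2 * y)\<^sup>2) = 2 * x\<^sup>2 + 6 * y\<^sup>2"
    by (simp add: power2_eq_square algebra_simps)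
  also have "\<dots> = (u - u')\<^sup>2 + (v - v')\<^sup>2" by (simp add: x2 y2)
  finally have "(x + y)\<^sup>2 + ((y - x)\<^sup>2 + (- 2 * y)\<^sup>2) = (u - u')\<^sup>2 + (v - v')\<^sup>2" .
  moreover have "(pi / 3 + u / sqrt 2 + v / sqrt 6) - (pi / 3 + u' / sqrt 2 + v' / sqrt 6) = x + y"
    "(pi / 3 - u / sqrt 2 + v / sqrt 6) - (pi / 3 - u' / sqrt 2 + v' / sqrt 6) = y - x"
    "(pi / 3 - 2 * v / sqrt 6) - (pi / 3 - 2 * v' / sqrt 6) = - 2 * y"
    by (simp_all add: x_def y_def diff_divide_distrib)
  ultimately show ?thesis
    unfolding p q shape_chart_def prod.case dist_Pair_Pair dist_real_def
    by (simp only: power2_abs real_sqrt_pow2 sum_power2_ge_zero)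
qed

lemma range_shape_chart: "range shape_chart = {(\<alpha>, \<beta>, \<gamma>). \<alpha> + \<beta> + \<gamma> = pi}"
proof (intro equalityI subsetI)
  fix x assume "x \<in> range shape_chart"
  then show "x \<in> {(\<alpha>, \<beta>, \<gamma>). \<alpha> + \<beta> + \<gamma> = pi}"
    by (auto simp: shape_chart_def)
next
  fix x :: "real \<times> real \<times> real"
  assume "x \<in> {(\<alpha>, \<beta>, \<gamma>). \<alpha> + \<beta> + \<gamma> = pi}"
  then obtain a b where x: "x = (a, b, pi - a - b)"
    by (cases x) (auto simp: algebra_simps)
  have "x = shape_chart ((a - b) / 2 * sqrt 2, (a + b - 2 * pi / 3) / 2 * sqrt 6)"
    by (simp add: x shape_chart_def field_simps)
  then show "x \<in> range shape_chart" by blast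
qed

lemma shape_chart_measurable [measurable]: "shape_chart \<in> lborel \<rightarrow>\<^sub>M borel"
proof -
  have "continuous_on UNIV shape_chart"
    unfolding shape_chart_def case_prod_beta by (intro continuous_intros) auto
  then show ?thesis by (simp add: borel_measurable_continuous_onI)
qed

text \<open>
  Completing the image measure makes every subset of a null set measurable, as for Lebesgue
  (rather than Borel) measure on the plane.
\<close>

definition shape_lebesgue :: "(real \<times> real \<times> real) measure" where
  "shape_lebesgue = completion (distr lborel borel shape_chart)"

definition almost_every_triangle :: "(real \<times> real \<times> real \<Rightarrow> bool) \<Rightarrow> bool" where
  "almost_every_triangle Q \<longleftrightarrow>
     (\<exists>S'. S' \<subseteq> triangle_shapes \<and> S' \<in> null_sets shape_lebesgue \<and>
           (\<forall>T \<in> triangle_shapes - S'. Q T))"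

subsection \<open>Almost similar triangles in planar point sets\<close>

text \<open>The angle at the vertex \<open>b\<close>, between the rays towards \<open>a\<close> and \<open>c\<close>.\<close>

definition vertex_angle :: "real^2 \<Rightarrow> real^2 \<Rightarrow> real^2 \<Rightarrow> real" where
  "vertex_angle a b c = arccos (((a - b) \<bullet> (c - b)) / (norm (a - b) * norm (c - b)))"

definition angle_triple :: "real^2 \<Rightarrow> real^2 \<Rightarrow> real^2 \<Rightarrow> real \<times> real \<times> real" where
  "angle_triple a b c = (vertex_angle c a b, vertex_angle a b c, vertex_angle b c a)"

text \<open>Angle triples need not be listed in increasing order, so they are sorted before comparison.\<close>

definition eps_similar :: "real \<Rightarrow> real \<times> real \<times> real \<Rightarrow> real \<times> real \<times> real \<Rightarrow> bool" where
  "eps_similar \<epsilon> = (\<lambda>(\<alpha>', \<beta>', \<gamma>') (\<alpha>, \<beta>, \<gamma>).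
     list_all2 (\<lambda>x y. \<bar>x - y\<bar> < \<epsilon>) (sort [\<alpha>, \<beta>, \<gamma>]) (sort [\<alpha>', \<beta>', \<gamma>']))"

definition similar_triangles ::
    "(real^2) set \<Rightarrow> real \<times> real \<times> real \<Rightarrow> real \<Rightarrow> (real^2) set set" where
  "similar_triangles P T \<epsilon> =
     {t. t \<subseteq> P \<and> card t = 3 \<and> \<not> collinear t \<and>
         (\<exists>a b c. t = {a, b, c} \<and> eps_similar \<epsilon> (angle_triple a b c) T)}"

definition h :: "nat \<Rightarrow> real \<times> real \<times> real \<Rightarrow> real \<Rightarrow> nat" where
  "h n T \<epsilon> = Max {card (similar_triangles P T \<epsilon>) | P. finite P \<and> card P = n}"

text \<open>The maximum in the definition of \<open>h\<close> is taken over a finite nonempty set of values.\<close>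

lemma h_values_finite:
  "finite {card (similar_triangles P T \<epsilon>) | P. finite P \<and> card P = n}"
proof (rule finite_subset)
  show "{card (similar_triangles P T \<epsilon>) | P. finite P \<and> card P = n} \<subseteq> {..2 ^ n}"
  proof clarsimp
    fix P :: "(real^2) set" assume P: "finite P"
    have "card (similar_triangles P T \<epsilon>) \<le> card (Pow P)"
      by (rule card_mono) (auto simp: P similar_triangles_def)
    then show "card (similar_triangles P T \<epsilon>) \<le> 2 ^ card P"
      by (simp add: P card_Pow)
  qed
qed simp

lemma h_values_nonempty:
  "{card (similar_triangles P T \<epsilon>) | P. finite P \<and> card P = n} \<noteq> {}"
proof -
  have "infinite (UNIV :: (real^2) set)"
    using finite_imp_bounded not_bounded_UNIV by blast
  then obtain P :: "(real^2) set" where "finite P" "card P = n"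
    by (metis infinite_arbitrarily_large)
  then show ?thesis by blast
qed

end

theory Submission
  imports Defs "Jordan_Normal_Form.Determinant"
begin

text \<open>
  Place the plane in the complex numbers. A triangle with vertices \<open>a\<close>, \<open>b\<close>, \<open>c\<close> and angles \<open>\<alpha>\<close> at \<open>a\<close>
  and \<open>\<beta>\<close> at \<open>b\<close> satisfies \<open>c - a = w * (b - a)\<close>, where \<open>w\<close> is \<open>z = apex \<alpha> \<beta>\<close> or its conjugate,
  according to the orientation. Hence a set of points with a given pattern of triangles
  \<open>\<epsilon>\<close>-similar to the shape of \<open>z\<close> is a nonconstant solution of a homogeneous linear system with one
  equation per triangle and coefficients near \<open>z\<close> and \<open>cnj z\<close>.

  The upper bound compares this system with the one in which all coefficients are \<open>- 1\<close>, with the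
  equations \<open>b + c = 2 * a\<close>. If the latter has only constant solutions, a certain determinant, which is
  a polynomial in the coefficients, does not vanish at \<open>- 1\<close>. It then vanishes only for a null set of
  shapes (\<open>singular_pairs_null\<close>), and for all other shapes it remains nonzero when the coefficients
  are perturbed a little, so that the pattern cannot occur for small \<open>\<epsilon>\<close>. Otherwise there is a
  nonconstant integer solution; after removing common factors 3 it remains nonconstant modulo 3, where
  the equations become \<open>a + b + c = 0\<close>. Three elements of \<open>\<int>/3\<int>\<close> with sum zero are either equal or
  pairwise distinct. So for almost every shape each set of at least two points can be coloured, not
  constantly, with three colours such that every triangle is monochromatic or rainbow
  (\<open>generic_colouring\<close>).

  For such an \<open>\<epsilon>\<close>, let \<open>h n\<close> be the largest possible number of triangles among \<open>n\<close> points, so that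
  \<open>h 0 = h 1 = 0\<close>. For \<open>n \<ge> 2\<close> the colouring yields \<open>h n \<le> a * b * c + h a + h b + h c\<close> for some
  \<open>a + b + c = n\<close> with \<open>a, b, c < n\<close>, and \<open>(n ^ 3 - n) / 24\<close> is an upper bound for the solutions of this recursion (\<open>card_edges_of_three_colourable\<close>). If \<open>n\<close> is a power
  of 3, always taking three equal parts gives equality; it is realised by the vertices of a triangle
  of the given shape, each replaced by a tiny copy of the construction for \<open>n / 3\<close>
  (\<open>exists_many_similar_triangles\<close>).
\<close>

section \<open>Linear systems attached to patterns of triangles\<close>

text \<open>
  Indexing by an initial segment of the naturals rather than by a finite type allows the size to be
  the number of points, and makes the determinant visibly a polynomial in the entries.
\<close>

definition leibniz_det :: "nat \<Rightarrow> (nat \<Rightarrow> nat \<Rightarrow> 'a::comm_ring_1) \<Rightarrow> 'a" where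
  "leibniz_det n A = (\<Sum>\<pi> | \<pi> permutes {..<n}. of_int (sign \<pi>) * (\<Prod>i<n. A i (\<pi> i)))"

lemma leibniz_det_eq_0_iff:
  fixes A :: "nat \<Rightarrow> nat \<Rightarrow> 'a::idom"
  shows "leibniz_det n A = 0 \<longleftrightarrow>
    (\<exists>x. (\<exists>i<n. x i \<noteq> 0) \<and> (\<forall>i<n. (\<Sum>j<n. A i j * x j) = 0))"
proof -
  define M where "M = mat n n (\<lambda>(i, j). A i j)"
  have M: "M \<in> carrier_mat n n"
    by (simp add: M_def)
  have det: "Determinant.det M = leibniz_det n A"
    unfolding leibniz_det_def det_def'[OF M]
    by (auto simp: M_def sign_def lessThan_atLeast0 permutes_in_image intro!: sum.cong prod.cong)
  have mult: "(M *\<^sub>v v = 0\<^sub>v n) \<longleftrightarrow> (\<forall>i<n. (\<Sum>j<n. A i j * vec_index v j) = 0)"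
    if "v \<in> carrier_vec n" for v
    using that by (auto simp: vec_eq_iff M_def scalar_prod_def lessThan_atLeast0)
  have ex: "(\<exists>v \<in> carrier_vec n. v \<noteq> 0\<^sub>v n \<and> M *\<^sub>v v = 0\<^sub>v n) \<longleftrightarrow>
    (\<exists>x. (\<exists>i<n. x i \<noteq> 0) \<and> (\<forall>i<n. (\<Sum>j<n. A i j * x j) = 0))" (is "?L \<longleftrightarrow> ?R")
  proof
    assume ?L
    then obtain v where v: "v \<in> carrier_vec n" "v \<noteq> 0\<^sub>v n" "M *\<^sub>v v = 0\<^sub>v n"
      by blast
    then have "\<exists>i<n. vec_index v i \<noteq> 0"
      by (auto simp: vec_eq_iff)
    with v show ?R
      using mult[OF v(1)] by blast
  next
    assume ?R
    then obtain x where x: "\<exists>i<n. x i \<noteq> 0" "\<forall>i<n. (\<Sum>j<n. A i j * x j) = 0"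
      by blast
    have "vec n x \<in> carrier_vec n" "vec n x \<noteq> 0\<^sub>v n"
      using x(1) by (auto simp: vec_eq_iff)
    moreover have "M *\<^sub>v vec n x = 0\<^sub>v n"
      using x(2) by (subst mult) auto
    ultimately show ?L
      by blast
  qed
  show ?thesis
    unfolding det[symmetric] det_0_iff_vec_prod_zero[OF M] ex[symmetric] by blast
qed

lemma of_int_leibniz_det: "of_int (leibniz_det n A) = leibniz_det n (\<lambda>i j. of_int (A i j))"
  by (simp add: leibniz_det_def)

text \<open>
  A role \<open>(a, b, c, \<sigma>)\<close> stands for a triangle with a chosen labelling of its vertices: \<open>a\<close> carries the
  angle \<open>\<alpha>\<close>, \<open>b\<close> the angle \<open>\<beta>\<close> and \<open>c\<close> the angle \<open>\<gamma>\<close>, and \<open>\<sigma>\<close> tells the orientation. For points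
  \<open>x\<close> in the complex plane this means \<open>x c - x a = w * (x b - x a)\<close> with \<open>w\<close> close to a number \<open>z\<close>
  that depends only on the shape if \<open>\<sigma>\<close> holds, and to its conjugate otherwise.
\<close>

type_synonym role = "nat \<times> nat \<times> nat \<times> bool"

definition edge_row :: "role \<Rightarrow> 'a::comm_ring_1 \<Rightarrow> nat \<Rightarrow> 'a" where
  "edge_row = (\<lambda>(a, b, c, \<sigma>) w j. of_bool (j = c) + (w - 1) * of_bool (j = a) - w * of_bool (j = b))"

definition edge_form :: "role \<Rightarrow> 'a::comm_ring_1 \<Rightarrow> (nat \<Rightarrow> 'a) \<Rightarrow> 'a" where
  "edge_form = (\<lambda>(a, b, c, \<sigma>) w x. (x c - x a) - w * (x b - x a))"

text \<open>
  With \<open>M w\<close> the matrix of the linear system and \<open>D\<close> the diagonal projection onto \<open>F\<close>, this is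
  \<open>(M (- 1))\<^sup>T * M w + D\<close>. Its kernel contains the solutions of the system that vanish on \<open>F\<close>, for
  every \<open>w\<close>, and it is square, so that a single determinant decides whether such solutions exist.
  The indices in \<open>F\<close> will be those of the points left out together with one point moved to the origin,
  which removes the constant solutions.
\<close>

definition gram :: "role set \<Rightarrow> nat set \<Rightarrow> (role \<Rightarrow> 'a::comm_ring_1) \<Rightarrow> nat \<Rightarrow> nat \<Rightarrow> 'a" where
  "gram E F w i j = (\<Sum>e\<in>E. edge_row e (- 1) i * edge_row e (w e) j) + of_bool (i = j \<and> i \<in> F)"

abbreviation roles :: "nat \<Rightarrow> role set" where
  "roles n \<equiv> {..<n} \<times> {..<n} \<times> {..<n} \<times> UNIV"

lemma sum_edge_row:
  assumes "e \<in> roles n"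
  shows "(\<Sum>j<n. edge_row e w j * x j) = edge_form e w x"
proof -
  have *: "(\<Sum>j<n. k * of_bool (j = i) * x j) = k * x i" if "i < n" for i and k :: 'a
  proof -
    have "(\<Sum>j<n. k * of_bool (j = i) * x j) = (\<Sum>j<n. if j = i then k * x j else 0)"
      by (intro sum.cong) auto
    also have "\<dots> = k * x i"
      using that by (subst sum.delta) auto
    finally show ?thesis .
  qed
  obtain a b c \<sigma> where e: "e = (a, b, c, \<sigma>)" "a < n" "b < n" "c < n"
    using assms by auto
  have "(\<Sum>j<n. edge_row e w j * x j) =
      (\<Sum>j<n. 1 * of_bool (j = c) * x j + (w - 1) * of_bool (j = a) * x j - w * of_bool (j = b) * x j)"
    by (intro sum.cong refl) (simp add: edge_row_def e algebra_simps)
  also have "\<dots> = edge_form e w x"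
    unfolding sum.distrib sum_subtractf using e by (simp only: *) (simp add: edge_form_def algebra_simps)
  finally show ?thesis .
qed

lemma sum_gram:
  assumes "E \<subseteq> roles n" "i < n"
  shows "(\<Sum>j<n. gram E F w i j * x j) =
    (\<Sum>e\<in>E. edge_row e (- 1) i * edge_form e (w e) x) + of_bool (i \<in> F) * x i"
proof -
  have "(\<Sum>j<n. gram E F w i j * x j) =
      (\<Sum>j<n. (\<Sum>e\<in>E. edge_row e (- 1) i * (edge_row e (w e) j * x j)) +
              (if j = i then of_bool (i \<in> F) * x i else 0))"
    by (intro sum.cong) (auto simp: gram_def sum_distrib_left algebra_simps)
  also have "\<dots> = (\<Sum>e\<in>E. \<Sum>j<n. edge_row e (- 1) i * (edge_row e (w e) j * x j)) + of_bool (i \<in> F) * x i"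
    using assms(2) by (simp add: sum.distrib sum.swap[of _ E])
  also have "(\<Sum>e\<in>E. \<Sum>j<n. edge_row e (- 1) i * (edge_row e (w e) j * x j)) =
      (\<Sum>e\<in>E. edge_row e (- 1) i * edge_form e (w e) x)"
    using assms(1) by (intro sum.cong refl) (auto simp: sum_distrib_left[symmetric] sum_edge_row subsetD)
  finally show ?thesis .
qed

text \<open>
  At \<open>w = - 1\<close> over the integers, the quadratic form of the matrix is a sum of squares, so its kernel
  contains nothing but solutions of the system.
\<close>

lemma gram_int_kernel:
  fixes x :: "nat \<Rightarrow> int"
  assumes E: "E \<subseteq> roles n" and F: "F \<subseteq> {..<n}"
    and ker: "\<And>i. i < n \<Longrightarrow> (\<Sum>j<n. gram E F (\<lambda>_. - 1) i j * x j) = 0"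
  shows "\<forall>e\<in>E. edge_form e (- 1) x = 0" "\<forall>i\<in>F. x i = 0"
proof -
  have fin: "finite E" "finite F"
    using E F by (auto intro: finite_subset)
  have "0 = (\<Sum>i<n. x i * (\<Sum>j<n. gram E F (\<lambda>_. - 1) i j * x j))"
    using ker by simp
  also have "\<dots> = (\<Sum>i<n. (\<Sum>e\<in>E. edge_row e (- 1) i * x i * edge_form e (- 1) x) + (if i \<in> F then x i * x i else 0))"
    by (intro sum.cong refl, simp only: sum_gram[OF E] lessThan_iff)
      (simp add: sum_distrib_left algebra_simps)
  also have "\<dots> = (\<Sum>e\<in>E. \<Sum>i<n. edge_row e (- 1) i * x i * edge_form e (- 1) x) + (\<Sum>i<n. if i \<in> F then x i * x i else 0)"
    by (simp add: sum.distrib sum.swap[of _ E])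
  also have "(\<Sum>e\<in>E. \<Sum>i<n. edge_row e (- 1) i * x i * edge_form e (- 1) x) = (\<Sum>e\<in>E. (edge_form e (- 1) x)\<^sup>2)"
    using E by (intro sum.cong refl)
      (auto simp: sum_distrib_right[symmetric] sum_edge_row subsetD power2_eq_square)
  also have "(\<Sum>i<n. if i \<in> F then x i * x i else 0) = (\<Sum>i\<in>F. (x i)\<^sup>2)"
    using F by (simp add: sum.If_cases Int_absorb1 power2_eq_square)
  finally have *: "(\<Sum>e\<in>E. (edge_form e (- 1) x)\<^sup>2) + (\<Sum>i\<in>F. (x i)\<^sup>2) = 0" ..
  moreover have "(\<Sum>e\<in>E. (edge_form e (- 1) x)\<^sup>2) \<ge> 0" "(\<Sum>i\<in>F. (x i)\<^sup>2) \<ge> 0"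
    by (auto intro: sum_nonneg)
  ultimately have "(\<Sum>e\<in>E. (edge_form e (- 1) x)\<^sup>2) = 0" "(\<Sum>i\<in>F. (x i)\<^sup>2) = 0"
    by linarith+
  then show "\<forall>e\<in>E. edge_form e (- 1) x = 0" "\<forall>i\<in>F. x i = 0"
    using fin by (auto simp: sum_nonneg_eq_0_iff)
qed

text \<open>
  Dividing by 3 as long as possible strictly decreases the sum of absolute values.
\<close>

lemma primitive_multiple:
  fixes x :: "nat \<Rightarrow> int"
  assumes "\<exists>i<n. x i \<noteq> 0"
  shows "\<exists>y k. k \<noteq> 0 \<and> (\<forall>i<n. x i = k * y i) \<and> (\<exists>i<n. \<not> 3 dvd y i)"
  using assms
proof (induction "\<Sum>i<n. nat \<bar>x i\<bar>" arbitrary: x rule: less_induct)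
  case less
  show ?case
  proof (cases "\<exists>i<n. \<not> 3 dvd x i")
    case True
    then show ?thesis
      by (intro exI[of _ x] exI[of _ 1]) auto
  next
    case False
    define x' where "x' i = x i div 3" for i
    have x: "x i = 3 * x' i" if "i < n" for i
      using False that by (simp add: x'_def)
    obtain i where i: "i < n" "x i \<noteq> 0"
      using less.prems by blast
    then have "x' i \<noteq> 0"
      using x by force
    moreover have "(\<Sum>i<n. nat \<bar>x' i\<bar>) < (\<Sum>i<n. nat \<bar>x i\<bar>)"
      using i x by (intro sum_strict_mono_ex1) force+
    ultimately obtain y k where yk: "k \<noteq> 0" "\<forall>i<n. x' i = k * y i" "\<exists>i<n. \<not> 3 dvd y i"
      using less.hyps[of x'] i by blast
    then show ?thesis
      by (intro exI[of _ y] exI[of _ "3 * k"]) (auto simp: x)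
  qed
qed

lemma singular_gram_primitive_solution:
  assumes E: "E \<subseteq> roles n" and F: "F \<subseteq> {..<n}"
    and det: "leibniz_det n (gram E F (\<lambda>_. - 1 :: int)) = 0"
  obtains y :: "nat \<Rightarrow> int" where "\<exists>i<n. \<not> 3 dvd y i" "\<forall>i\<in>F. y i = 0"
    "\<forall>(a, b, c, \<sigma>)\<in>E. y b + y c = 2 * y a"
proof -
  obtain x :: "nat \<Rightarrow> int" where x: "\<exists>i<n. x i \<noteq> 0"
    and ker: "\<forall>i<n. (\<Sum>j<n. gram E F (\<lambda>_. - 1) i j * x j) = 0"
    using det unfolding leibniz_det_eq_0_iff by blast
  have sol: "\<forall>e\<in>E. edge_form e (- 1) x = 0" "\<forall>i\<in>F. x i = 0"
    using gram_int_kernel[OF E F] ker by blast+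
  obtain y k where y: "k \<noteq> 0" "\<forall>i<n. x i = k * y i" "\<exists>i<n. \<not> 3 dvd y i"
    using primitive_multiple[OF x] by blast
  have "y b + y c = 2 * y a" if e: "(a, b, c, \<sigma>) \<in> E" for a b c \<sigma>
  proof -
    have abc: "a < n" "b < n" "c < n"
      using e E by auto
    have "x b + x c = 2 * x a"
      using sol(1) e by (force simp: edge_form_def)
    then have "k * (y b + y c) = k * (2 * y a)"
      using y(2) abc by (simp add: algebra_simps)
    then show ?thesis
      using y(1) by simp
  qed
  moreover have "y i = 0" if "i \<in> F" for i
    using sol(2) that y F by auto
  ultimately show thesis
    using y(3) that by blast
qed

lemma of_int_gram:
  "of_int (gram E F (\<lambda>_. - 1) i j) = (gram E F (\<lambda>_. - 1) i j :: 'a::comm_ring_1)"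
proof -
  have "of_int (edge_row e (- 1) i) = (edge_row e (- 1) i :: 'a)" for e :: role and i
    by (cases e) (simp add: edge_row_def)
  then show ?thesis
    by (simp add: gram_def)
qed

lemma of_int_det_gram:
  "of_int (leibniz_det n (gram E F (\<lambda>_. - 1))) =
    (leibniz_det n (gram E F (\<lambda>_. - 1)) :: 'a::comm_ring_1)"
  by (simp add: of_int_leibniz_det of_int_gram)

section \<open>Colourings from generic shapes\<close>

definition shape_weights :: "complex \<Rightarrow> complex \<Rightarrow> role \<Rightarrow> complex" where
  "shape_weights s t = (\<lambda>(a, b, c, positive). if positive then s else t)"

definition shape_det :: "nat \<Rightarrow> role set \<Rightarrow> nat set \<Rightarrow> complex \<Rightarrow> complex \<Rightarrow> complex" where
  "shape_det n E F s t = leibniz_det n (gram E F (shape_weights s t))"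

text \<open>
  For these patterns no nonzero vector solves the system and vanishes on \<open>F\<close> when every coefficient
  is \<open>- 1\<close>; as the determinant is a polynomial in the coefficients, the same then holds for generic
  coefficients.
\<close>

definition rigid_patterns :: "nat \<Rightarrow> (role set \<times> nat set) set" where
  "rigid_patterns n = {(E, F). E \<subseteq> roles n \<and> F \<subseteq> {..<n} \<and>
     leibniz_det n (gram E F (\<lambda>_. - 1 :: int)) \<noteq> 0}"

lemma finite_rigid_patterns: "finite (rigid_patterns n)"
proof (rule finite_subset)
  show "rigid_patterns n \<subseteq> Pow (roles n) \<times> Pow {..<n}"
    by (auto simp: rigid_patterns_def)
qed auto

definition generic_shape :: "nat \<Rightarrow> complex \<Rightarrow> bool" where
  "generic_shape n z \<longleftrightarrow> (\<forall>(E, F)\<in>rigid_patterns n. shape_det n E F z (cnj z) \<noteq> 0)"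

lemma det_gram_stable:
  fixes w\<^sub>0 :: "role \<Rightarrow> complex"
  assumes E: "finite E" and nz: "leibniz_det n (gram E F w\<^sub>0) \<noteq> 0"
  shows "\<exists>\<delta>>0. \<forall>w. (\<forall>e\<in>E. dist (w e) (w\<^sub>0 e) < \<delta>) \<longrightarrow> leibniz_det n (gram E F w) \<noteq> 0"
proof (rule ccontr)
  assume neg: "\<not> ?thesis"
  have "\<exists>w. (\<forall>e\<in>E. dist (w e) (w\<^sub>0 e) < inverse (real (Suc k))) \<and> leibniz_det n (gram E F w) = 0" for k
  proof -
    have "inverse (real (Suc k)) > 0"
      by simp
    then show ?thesis
      using neg by blast
  qed
  then obtain w where w: "\<And>k e. e \<in> E \<Longrightarrow> dist (w k e) (w\<^sub>0 e) < inverse (real (Suc k))"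
    and zero: "\<And>k. leibniz_det n (gram E F (w k)) = 0"
    by metis
  have lim: "(\<lambda>k. w k e) \<longlonglongrightarrow> w\<^sub>0 e" if "e \<in> E" for e
  proof (rule metric_tendsto_imp_tendsto[OF LIMSEQ_inverse_real_of_nat])
    show "\<forall>\<^sub>F k in sequentially. dist (w k e) (w\<^sub>0 e) \<le> dist (inverse (real (Suc k))) 0"
      using w[OF that] by (intro always_eventually allI) (simp add: less_imp_le)
  qed
  have "(\<lambda>k. edge_row e (w k e) j) \<longlonglongrightarrow> edge_row e (w\<^sub>0 e) j" if "e \<in> E" for e j
    using lim[OF that] by (cases e) (auto simp: edge_row_def intro!: tendsto_intros)
  then have "(\<lambda>k. leibniz_det n (gram E F (w k))) \<longlonglongrightarrow> leibniz_det n (gram E F w\<^sub>0)"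
    unfolding leibniz_det_def gram_def by (intro tendsto_intros) auto
  then show False
    using nz by (simp add: zero LIMSEQ_const_iff)
qed

text \<open>
  For a fixed number of points there are only finitely many patterns, hence one \<open>\<delta>\<close> serves all of them.
\<close>

lemma generic_shape_stable:
  assumes "generic_shape n z"
  obtains \<delta> where "\<delta> > 0" "\<And>E F w. \<lbrakk>(E, F) \<in> rigid_patterns n;
      \<And>e. e \<in> E \<Longrightarrow> dist (w e) (shape_weights z (cnj z) e) < \<delta>\<rbrakk> \<Longrightarrow>
      leibniz_det n (gram E F w) \<noteq> 0"
proof -
  have "\<exists>\<delta>>0. \<forall>w. (\<forall>e\<in>fst i. dist (w e) (shape_weights z (cnj z) e) < \<delta>) \<longrightarrow>
      leibniz_det n (gram (fst i) (snd i) w) \<noteq> 0" if "i \<in> rigid_patterns n" for i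
  proof (rule det_gram_stable)
    show "finite (fst i)"
    proof (rule finite_subset)
      show "fst i \<subseteq> roles n"
        using that by (auto simp: rigid_patterns_def)
    qed simp
    show "leibniz_det n (gram (fst i) (snd i) (shape_weights z (cnj z))) \<noteq> 0"
      using that assms by (auto simp: generic_shape_def shape_det_def)
  qed
  then have "\<forall>i\<in>rigid_patterns n. \<exists>\<delta>. \<delta> > 0 \<and> (\<forall>w. (\<forall>e\<in>fst i. dist (w e) (shape_weights z (cnj z) e) < \<delta>) \<longrightarrow>
      leibniz_det n (gram (fst i) (snd i) w) \<noteq> 0)"
    by blast
  from bchoice[OF this] obtain d where d: "\<And>i. i \<in> rigid_patterns n \<Longrightarrow> d i > 0"
    "\<And>i w. i \<in> rigid_patterns n \<Longrightarrow> (\<forall>e\<in>fst i. dist (w e) (shape_weights z (cnj z) e) < d i) \<Longrightarrow>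
      leibniz_det n (gram (fst i) (snd i) w) \<noteq> 0"
    by blast
  define \<delta> where "\<delta> = Min (insert 1 (d ` rigid_patterns n))"
  show thesis
  proof
    show "\<delta> > 0"
      using finite_rigid_patterns d(1) by (auto simp: \<delta>_def)
    fix E F and w :: "role \<Rightarrow> complex"
    assume I: "(E, F) \<in> rigid_patterns n"
      and near: "\<And>e. e \<in> E \<Longrightarrow> dist (w e) (shape_weights z (cnj z) e) < \<delta>"
    have "\<delta> \<le> d (E, F)"
      using finite_rigid_patterns I by (auto simp: \<delta>_def)
    then have "\<forall>e\<in>E. dist (w e) (shape_weights z (cnj z) e) < d (E, F)"
      using near less_le_trans by blast
    then show "leibniz_det n (gram E F w) \<noteq> 0"
      using d(2)[OF I, of w] by simp
  qed
qed

definition shape_ratio :: "complex \<Rightarrow> complex \<Rightarrow> complex \<Rightarrow> complex" where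
  "shape_ratio a b c = (c - a) / (b - a)"

text \<open>
  The roles that are nearly realised by the points of \<open>V\<close> form a pattern whose system has a nonconstant
  solution, namely the points themselves, with coefficients near \<open>z\<close> and \<open>cnj z\<close>. As \<open>z\<close> is generic,
  the pattern is not rigid, so the system with all coefficients \<open>- 1\<close> has a nonconstant solution in
  integers. Its equations \<open>y b + y c = 2 * y a\<close> read \<open>y a + y b + y c = 0\<close> modulo 3, which holds in
  \<open>\<int>/3\<int>\<close> exactly if the three residues are all equal or all distinct.
\<close>

lemma generic_colouring:
  assumes "generic_shape n z"
  shows "\<exists>\<delta>>0. \<forall>p V. inj_on p {..<n} \<longrightarrow> V \<subseteq> {..<n} \<longrightarrow> card V \<ge> 2 \<longrightarrow>
      (\<exists>\<phi> :: nat \<Rightarrow> int. range \<phi> \<subseteq> {0, 1, 2} \<and> \<not> \<phi> constant_on V \<and>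
        (\<forall>a\<in>V. \<forall>b\<in>V. \<forall>c\<in>V. a \<noteq> b \<longrightarrow>
          dist (shape_ratio (p a) (p b) (p c)) z < \<delta> \<or>
          dist (shape_ratio (p a) (p b) (p c)) (cnj z) < \<delta> \<longrightarrow>
          \<phi> a = \<phi> b \<and> \<phi> b = \<phi> c \<or> \<phi> a \<noteq> \<phi> b \<and> \<phi> b \<noteq> \<phi> c \<and> \<phi> a \<noteq> \<phi> c))"
proof -
  obtain \<delta> where \<delta>: "\<delta> > 0" and stable: "\<And>E F w. \<lbrakk>(E, F) \<in> rigid_patterns n;
      \<And>e. e \<in> E \<Longrightarrow> dist (w e) (shape_weights z (cnj z) e) < \<delta>\<rbrakk> \<Longrightarrow>
      leibniz_det n (gram E F w) \<noteq> 0"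
    using generic_shape_stable[OF assms] by blast
  show ?thesis
  proof (intro exI[of _ \<delta>] conjI \<delta> allI impI)
    fix p :: "nat \<Rightarrow> complex" and V
    assume inj: "inj_on p {..<n}" and V: "V \<subseteq> {..<n}" "card V \<ge> 2"
    obtain v\<^sub>0 v\<^sub>1 where v: "v\<^sub>0 \<in> V" "v\<^sub>1 \<in> V" "v\<^sub>0 \<noteq> v\<^sub>1"
      using V card_le_Suc0_iff_eq[of V] by (fastforce dest: finite_subset)
    \<comment> \<open>Taking the exact ratios as coefficients turns the approximate system into an exact one.\<close>
    define w :: "role \<Rightarrow> complex" where "w = (\<lambda>(a, b, c, _). shape_ratio (p a) (p b) (p c))"
    define E where "E = {(a, b, c, \<sigma>). a \<in> V \<and> b \<in> V \<and> c \<in> V \<and> a \<noteq> b \<and>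
      dist (w (a, b, c, \<sigma>)) (shape_weights z (cnj z) (a, b, c, \<sigma>)) < \<delta>}"
    define F where "F = insert v\<^sub>0 ({..<n} - V)"
    have E: "E \<subseteq> roles n" and F: "F \<subseteq> {..<n}"
      using V(1) v by (auto simp: E_def F_def)
    \<comment> \<open>A nonzero kernel vector: the points of \<open>V\<close>, moved so that \<open>p v\<^sub>0\<close> is the origin, and 0 at the indices outside \<open>V\<close>.\<close>
    define x where "x i = (if i \<in> V then p i - p v\<^sub>0 else 0)" for i
    have "edge_form e (w e) x = 0" if eE: "e \<in> E" for e
    proof -
      obtain a b c \<sigma> where e: "e = (a, b, c, \<sigma>)" "a \<in> V" "b \<in> V" "c \<in> V" "a \<noteq> b"
        using eE unfolding E_def by blast
      have "p b - p a \<noteq> 0"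
        using e V(1) inj by (auto simp: inj_on_def)
      then show ?thesis
        using e by (simp add: edge_form_def w_def x_def shape_ratio_def)
    qed
    moreover have "of_bool (i \<in> F) * x i = 0" for i
      by (auto simp: F_def x_def)
    ultimately have "\<forall>i<n. (\<Sum>j<n. gram E F w i j * x j) = 0"
      by (simp add: sum_gram[OF E])
    moreover have "v\<^sub>1 < n" "x v\<^sub>1 \<noteq> 0"
      using v V(1) inj by (auto simp: x_def inj_on_def)
    ultimately have "leibniz_det n (gram E F w) = 0"
      unfolding leibniz_det_eq_0_iff by blast
    moreover have "dist (w e) (shape_weights z (cnj z) e) < \<delta>" if "e \<in> E" for e
      using that unfolding E_def by blast
    ultimately have "(E, F) \<notin> rigid_patterns n"
      using stable by metis
    then have "leibniz_det n (gram E F (\<lambda>_. - 1 :: int)) = 0"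
      using E F by (simp add: rigid_patterns_def)
    from singular_gram_primitive_solution[OF E F this]
    obtain y :: "nat \<Rightarrow> int" where y: "\<exists>i<n. \<not> 3 dvd y i" "\<forall>i\<in>F. y i = 0"
      "\<forall>(a, b, c, \<sigma>)\<in>E. y b + y c = 2 * y a"
      by blast
    define \<phi> where "\<phi> i = y i mod 3" for i
    have "range \<phi> \<subseteq> {0, 1, 2}"
    proof (rule image_subsetI)
      fix i
      have "0 \<le> y i mod 3" "y i mod 3 < 3"
        by simp_all
      then show "\<phi> i \<in> {0, 1, 2}"
        unfolding \<phi>_def by auto
    qed
    moreover have "\<not> \<phi> constant_on V"
    proof
      assume "\<phi> constant_on V"
      moreover obtain i where i: "i < n" "\<not> 3 dvd y i"
        using y(1) by blast
      moreover have "i \<in> V"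
      proof (rule ccontr)
        assume "i \<notin> V"
        then have "y i = 0"
          using i(1) y(2) unfolding F_def by blast
        with i(2) show False
          by simp
      qed
      ultimately have "\<phi> i = \<phi> v\<^sub>0"
        using v by (auto simp: constant_on_def)
      then show False
        using i(2) y(2) by (auto simp: \<phi>_def F_def)
    qed
    moreover have "\<phi> a = \<phi> b \<and> \<phi> b = \<phi> c \<or> \<phi> a \<noteq> \<phi> b \<and> \<phi> b \<noteq> \<phi> c \<and> \<phi> a \<noteq> \<phi> c"
      if abc: "a \<in> V" "b \<in> V" "c \<in> V" "a \<noteq> b"
        and near: "dist (shape_ratio (p a) (p b) (p c)) z < \<delta> \<or>
          dist (shape_ratio (p a) (p b) (p c)) (cnj z) < \<delta>" for a b c
    proof -
      have "(a, b, c, True) \<in> E \<or> (a, b, c, False) \<in> E"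
        using abc near by (auto simp: E_def w_def shape_weights_def)
      then have "y b + y c = 2 * y a"
        using y(3) by auto
      \<comment> \<open>All three differences are multiples of \<open>y a - y b\<close> by units modulo 3.\<close>
      then have "y c - y a = y a - y b" "y c - y b = 2 * (y a - y b)"
        by simp_all
      moreover have "3 dvd 2 * d \<longleftrightarrow> 3 dvd d" for d :: int
        by presburger
      ultimately have "\<phi> c = \<phi> a \<longleftrightarrow> \<phi> a = \<phi> b" "\<phi> c = \<phi> b \<longleftrightarrow> \<phi> a = \<phi> b"
        by (simp_all only: \<phi>_def mod_eq_dvd_iff)
      then show ?thesis
        by auto
    qed
    ultimately show "\<exists>\<phi> :: nat \<Rightarrow> int. range \<phi> \<subseteq> {0, 1, 2} \<and> \<not> \<phi> constant_on V \<and>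
        (\<forall>a\<in>V. \<forall>b\<in>V. \<forall>c\<in>V. a \<noteq> b \<longrightarrow>
          dist (shape_ratio (p a) (p b) (p c)) z < \<delta> \<or>
          dist (shape_ratio (p a) (p b) (p c)) (cnj z) < \<delta> \<longrightarrow>
          \<phi> a = \<phi> b \<and> \<phi> b = \<phi> c \<or> \<phi> a \<noteq> \<phi> b \<and> \<phi> b \<noteq> \<phi> c \<and> \<phi> a \<noteq> \<phi> c)"
      by blast
  qed
qed

section \<open>Counting edges under three-colourings\<close>

text \<open>
  The linear terms cancel, and the slack in the cubic terms is a nonnegative combination of squares
  that vanishes for \<open>a = b = c\<close>; this is where the constant \<open>1 / 24\<close> comes from.
\<close>

lemma cube_split:
  fixes a b c :: int
  assumes "a \<ge> 0" "b \<ge> 0" "c \<ge> 0"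
  shows "24 * (a * b * c) + (a ^ 3 - a) + (b ^ 3 - b) + (c ^ 3 - c) \<le> (a + b + c) ^ 3 - (a + b + c)"
proof -
  have "(a + b + c) ^ 3 - (a + b + c) - (24 * (a * b * c) + (a ^ 3 - a) + (b ^ 3 - b) + (c ^ 3 - c)) =
      3 * (a * (b - c)\<^sup>2 + b * (c - a)\<^sup>2 + c * (a - b)\<^sup>2)"
    by (simp add: power2_eq_square power3_eq_cube algebra_simps)
  also have "\<dots> \<ge> 0"
    using assms by simp
  finally show ?thesis
    by simp
qed

text \<open>
  If \<open>a\<close>, \<open>b\<close>, \<open>c\<close> are the sizes of the colour classes of \<open>V\<close>, there are at most \<open>a * b * c\<close> rainbow
  edges, and all others lie inside a class. The classes are proper subsets of \<open>V\<close>, so that induction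
  applies to them.
\<close>

lemma card_edges_of_three_colourable:
  fixes H :: "'a set set"
  assumes "finite P" and H: "\<And>t. t \<in> H \<Longrightarrow> card t = 3"
    and colouring: "\<And>V. V \<subseteq> P \<Longrightarrow> card V \<ge> 2 \<Longrightarrow> \<exists>\<phi> :: 'a \<Rightarrow> int.
      range \<phi> \<subseteq> {0, 1, 2} \<and> \<not> \<phi> constant_on V \<and>
      (\<forall>t\<in>H. t \<subseteq> V \<longrightarrow> \<phi> constant_on t \<or> inj_on \<phi> t)"
  shows "24 * int (card {t \<in> H. t \<subseteq> P}) \<le> int (card P) ^ 3 - int (card P)"
proof -
  have "24 * int (card {t \<in> H. t \<subseteq> V}) \<le> int (card V) ^ 3 - int (card V)" if "V \<subseteq> P" for V
    using that
  proof (induction "card V" arbitrary: V rule: less_induct)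
    case less
    have finV: "finite V"
      using less.prems \<open>finite P\<close> by (rule finite_subset)
    show ?case
    proof (cases "card V \<ge> 2")
      case False
      have none: "{t \<in> H. t \<subseteq> V} = {}"
      proof -
        have "\<not> t \<subseteq> V" if "t \<in> H" for t
          using False H[OF that] card_mono[OF finV, of t] by linarith
        then show ?thesis
          by blast
      qed
      have "card V = 0 \<or> card V = 1"
        using False by linarith
      then show ?thesis
        unfolding none by (elim disjE) simp_all
    next
      case True
      obtain \<phi> :: "'a \<Rightarrow> int" where \<phi>: "range \<phi> \<subseteq> {0, 1, 2}" "\<not> \<phi> constant_on V"
        and edges: "\<forall>t\<in>H. t \<subseteq> V \<longrightarrow> \<phi> constant_on t \<or> inj_on \<phi> t"
        using colouring[OF less.prems True] by (elim exE conjE)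
      define fibre where "fibre k = {v \<in> V. \<phi> v = k}" for k
      have fin: "finite (fibre k)" for k
        using finV by (simp add: fibre_def)
      have V: "V = fibre 0 \<union> fibre 1 \<union> fibre 2"
        using \<phi>(1) by (auto simp: fibre_def)
      have card_V: "card V = card (fibre 0) + card (fibre 1) + card (fibre 2)"
      proof -
        have "fibre 0 \<inter> fibre 1 = {}" "(fibre 0 \<union> fibre 1) \<inter> fibre 2 = {}"
          by (auto simp: fibre_def)
        then show ?thesis
          using fin by (subst V) (simp add: card_Un_disjoint)
      qed
      have IH: "24 * int (card {t \<in> H. t \<subseteq> fibre k}) \<le> int (card (fibre k)) ^ 3 - int (card (fibre k))" for k
      proof (rule less.hyps)
        have "fibre k \<noteq> V"
          using \<phi>(2) by (auto simp: constant_on_def fibre_def)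
        then show "card (fibre k) < card V"
          by (intro psubset_card_mono[OF finV]) (auto simp: fibre_def)
        show "fibre k \<subseteq> P"
          using less.prems by (auto simp: fibre_def)
      qed
      define X where "X = {t \<in> H. t \<subseteq> V \<and> inj_on \<phi> t}"
      have "X \<subseteq> (\<lambda>(x, y, z). {x, y, z}) ` (fibre 0 \<times> fibre 1 \<times> fibre 2)"
      proof
        fix t assume "t \<in> X"
        then have t: "card t = 3" "t \<subseteq> V" "inj_on \<phi> t"
          using H by (auto simp: X_def)
        then have "finite t"
          by (simp add: card_ge_0_finite)
        have "card (\<phi> ` t) = 3"
          using t by (simp add: card_image)
        moreover have "\<phi> ` t \<subseteq> {0, 1, 2}"
          using \<phi>(1) by auto
        ultimately have "\<phi> ` t = {0, 1, 2}"
          by (intro card_subset_eq) auto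
        then have "0 \<in> \<phi> ` t" "1 \<in> \<phi> ` t" "2 \<in> \<phi> ` t"
          by auto
        then obtain x y z where xyz: "x \<in> t" "\<phi> x = 0" "y \<in> t" "\<phi> y = 1" "z \<in> t" "\<phi> z = 2"
          by (auto simp: image_iff)
        have "x \<noteq> y" "y \<noteq> z" "x \<noteq> z"
          using xyz by auto
        then have "{x, y, z} = t"
          using xyz t \<open>finite t\<close> by (intro card_subset_eq) auto
        then show "t \<in> (\<lambda>(x, y, z). {x, y, z}) ` (fibre 0 \<times> fibre 1 \<times> fibre 2)"
        proof (intro image_eqI[where x = "(x, y, z)"])
          show "(x, y, z) \<in> fibre 0 \<times> fibre 1 \<times> fibre 2"
            using xyz t(2) by (auto simp: fibre_def)
        qed simp
      qed
      then have "card X \<le> card (fibre 0 \<times> fibre 1 \<times> fibre 2)"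
        using fin by (intro surj_card_le) auto
      then have X: "card X \<le> card (fibre 0) * card (fibre 1) * card (fibre 2)"
        by (simp add: card_cartesian_product mult.assoc)
      have "{t \<in> H. t \<subseteq> V} \<subseteq>
          X \<union> ({t \<in> H. t \<subseteq> fibre 0} \<union> ({t \<in> H. t \<subseteq> fibre 1} \<union> {t \<in> H. t \<subseteq> fibre 2}))"
      proof
        fix t assume t: "t \<in> {t \<in> H. t \<subseteq> V}"
        show "t \<in> X \<union> ({t \<in> H. t \<subseteq> fibre 0} \<union> ({t \<in> H. t \<subseteq> fibre 1} \<union> {t \<in> H. t \<subseteq> fibre 2}))"
        proof (cases "inj_on \<phi> t")
          case True
          then show ?thesis
            using t by (simp add: X_def)
        next
          case False
          then have "\<phi> constant_on t"
            using edges t by blast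
          then obtain k where "\<forall>v\<in>t. \<phi> v = k"
            unfolding constant_on_def by blast
          then have "t \<subseteq> fibre k"
            using t by (auto simp: fibre_def)
          moreover have "t \<noteq> {}"
            using H[of t] t by auto
          ultimately have "k \<in> {0, 1, 2}"
            using \<phi>(1) by (auto simp: fibre_def)
          then show ?thesis
            using t \<open>t \<subseteq> fibre k\<close> by auto
        qed
      qed
      then have "card {t \<in> H. t \<subseteq> V} \<le>
          card (X \<union> ({t \<in> H. t \<subseteq> fibre 0} \<union> ({t \<in> H. t \<subseteq> fibre 1} \<union> {t \<in> H. t \<subseteq> fibre 2})))"
      proof (rule card_mono[rotated])
        have "X \<subseteq> Pow V"
          by (auto simp: X_def)
        then show "finite (X \<union> ({t \<in> H. t \<subseteq> fibre 0} \<union> ({t \<in> H. t \<subseteq> fibre 1} \<union> {t \<in> H. t \<subseteq> fibre 2})))"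
          using fin finV by (auto intro: finite_subset)
      qed
      also have "\<dots> \<le> card X + (card {t \<in> H. t \<subseteq> fibre 0} +
          (card {t \<in> H. t \<subseteq> fibre 1} + card {t \<in> H. t \<subseteq> fibre 2}))"
        by (intro order_trans[OF card_Un_le] add_left_mono order_refl)
      finally have "24 * int (card {t \<in> H. t \<subseteq> V}) \<le> 24 * int (card (fibre 0) * card (fibre 1) * card (fibre 2)) +
          24 * int (card {t \<in> H. t \<subseteq> fibre 0}) + 24 * int (card {t \<in> H. t \<subseteq> fibre 1}) +
          24 * int (card {t \<in> H. t \<subseteq> fibre 2})"
        using X by linarith
      also have "\<dots> \<le> int (card V) ^ 3 - int (card V)"
        using IH[of 0] IH[of 1] IH[of 2]
          cube_split[of "int (card (fibre 0))" "int (card (fibre 1))" "int (card (fibre 2))"]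
        by (simp add: card_V)
      finally show ?thesis .
    qed
  qed
  then show ?thesis
    by blast
qed

section \<open>Angles and complex ratios\<close>

definition to_complex :: "real^2 \<Rightarrow> complex" where
  "to_complex v = Complex (vec_nth v 1) (vec_nth v 2)"

lemma to_complex_diff: "to_complex (u - v) = to_complex u - to_complex v"
  by (simp add: to_complex_def complex_eq_iff)

lemma inner_to_complex: "to_complex u \<bullet> to_complex v = u \<bullet> v"
  by (simp add: to_complex_def inner_vec_def sum_2 inner_complex_def)

lemma norm_to_complex: "norm (to_complex v) = norm v"
  by (simp add: norm_eq_sqrt_inner inner_to_complex)

lemma inj_to_complex: "inj to_complex"
  by (rule injI) (simp add: to_complex_def Finite_Cartesian_Product.vec_eq_iff forall_2)

definition angle_at :: "'a::real_inner \<Rightarrow> 'a \<Rightarrow> 'a \<Rightarrow> real" where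
  "angle_at a b c = arccos (((a - b) \<bullet> (c - b)) / (norm (a - b) * norm (c - b)))"

lemma vertex_angle_to_complex:
  "vertex_angle a b c = angle_at (to_complex a) (to_complex b) (to_complex c)"
  by (simp add: vertex_angle_def angle_at_def inner_to_complex norm_to_complex flip: to_complex_diff)

lemma vertex_angle_sym: "vertex_angle a b c = vertex_angle c b a"
  by (simp add: vertex_angle_def inner_commute mult.commute)

lemma cos_angle_at: "cos (angle_at a b c) = ((a - b) \<bullet> (c - b)) / (norm (a - b) * norm (c - b))"
proof -
  have "\<bar>((a - b) \<bullet> (c - b)) / (norm (a - b) * norm (c - b))\<bar> \<le> 1"
    using Cauchy_Schwarz_ineq2[of "a - b" "c - b"]
    by (cases "a = b \<or> c = b") (auto simp: abs_divide abs_mult divide_le_eq)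
  then show ?thesis
    unfolding angle_at_def by (intro cos_arccos_abs)
qed

lemma cos_angle_at_ratio:
  fixes a b c :: complex
  assumes "b \<noteq> a"
  shows "cos (angle_at c a b) = Re ((c - a) / (b - a)) / norm ((c - a) / (b - a))"
proof -
  have "Re ((c - a) / (b - a)) = ((c - a) \<bullet> (b - a)) / (norm (b - a))\<^sup>2"
    unfolding complex_div_cnj[of "c - a"]
    by (simp add: inner_complex_def algebra_simps flip: of_real_power)
  moreover define q where "q = Re ((c - a) / (b - a))"
  ultimately have "(c - a) \<bullet> (b - a) = q * (norm (b - a))\<^sup>2"
    using assms by simp
  then show ?thesis
    using assms unfolding q_def[symmetric]
    by (cases "c = a") (simp_all add: cos_angle_at norm_divide power2_eq_square)
qed

text \<open>
  For positive angles with sum below \<open>pi\<close>, the third vertex of the triangle in the upper half plane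
  with vertices 0 and 1 that has the angle \<open>\<alpha>\<close> at 0 and \<open>\<beta>\<close> at 1; the distance from 0 is given by the law of sines.
\<close>

definition apex :: "real \<Rightarrow> real \<Rightarrow> complex" where
  "apex \<alpha> \<beta> = of_real (sin \<beta> / sin (\<alpha> + \<beta>)) * cis \<alpha>"

text \<open>
  Both \<open>w\<close> and \<open>1 - w\<close> determine the height of the triangle, up to sign, and their real parts add up
  to the base 1. Eliminating the length of \<open>1 - w\<close> gives the law of sines for that of \<open>w\<close>.
\<close>

lemma ratio_eq_apex:
  fixes w :: complex
  assumes A: "0 < A" "A < pi" "cos A = Re w / norm w"
    and B: "0 < B" "B < pi" "cos B = Re (1 - w) / norm (1 - w)"
    and w: "w \<noteq> 0" "w \<noteq> 1"
  shows "w = apex A B \<or> w = cnj (apex A B)"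
proof -
  define r where "r = norm w"
  define \<rho> where "\<rho> = norm (1 - w)"
  have pos: "r > 0" "\<rho> > 0" "sin A > 0" "sin B > 0"
    using w A B by (auto simp: r_def \<rho>_def sin_gt_zero)
  have re: "Re w = r * cos A" "1 - Re w = \<rho> * cos B"
    using A(3) B(3) pos by (simp_all add: r_def \<rho>_def)
  have "(Im w)\<^sup>2 = (r * sin A)\<^sup>2"
    using cmod_power2[of w] by (simp add: re power_mult_distrib sin_squared_eq right_diff_distrib flip: r_def)
  then have im: "Im w = r * sin A \<or> Im w = - (r * sin A)"
    by (simp add: power2_eq_iff)
  have "(Im w)\<^sup>2 = (\<rho> * sin B)\<^sup>2"
  proof -
    have "\<rho>\<^sup>2 = (\<rho> * cos B)\<^sup>2 + (Im w)\<^sup>2"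
      using cmod_power2[of "1 - w"] unfolding \<rho>_def[symmetric] re(2)[symmetric] by simp
    then show ?thesis
      by (simp add: power_mult_distrib sin_squared_eq right_diff_distrib)
  qed
  with \<open>(Im w)\<^sup>2 = (r * sin A)\<^sup>2\<close> have "r * sin A = \<rho> * sin B"
    using pos by (simp add: power2_eq_iff_nonneg)
  moreover have "r * cos A = 1 - \<rho> * cos B"
    using re by simp
  ultimately have "r * sin (A + B) = sin B"
    by (simp add: sin_add distrib_left mult.assoc[symmetric] left_diff_distrib)
  moreover from this have "sin (A + B) \<noteq> 0"
    using pos by auto
  ultimately have "r = sin B / sin (A + B)"
    by (simp add: field_simps)
  then show ?thesis
    using re im by (auto simp: apex_def complex_eq_iff)
qed

lemma shape_ratio_eq_apex:
  fixes a b c :: complex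
  assumes "a \<noteq> b" "a \<noteq> c" "b \<noteq> c"
    and "angle_at c a b \<in> {0<..<pi}" "angle_at a b c \<in> {0<..<pi}"
  defines "w \<equiv> (c - a) / (b - a)"
  shows "w = apex (angle_at c a b) (angle_at a b c) \<or> w = cnj (apex (angle_at c a b) (angle_at a b c))"
proof (rule ratio_eq_apex)
  have "(c - b) / (a - b) = 1 - w"
    using assms(1) by (simp add: w_def field_simps)
  moreover have "angle_at a b c = angle_at c b a"
    by (simp add: angle_at_def inner_commute mult.commute)
  ultimately show "cos (angle_at a b c) = Re (1 - w) / norm (1 - w)"
    using cos_angle_at_ratio[of a b c] assms(1) by simp
  show "cos (angle_at c a b) = Re w / norm w"
    using cos_angle_at_ratio[of b a c] assms(1) by (simp add: w_def)
qed (use assms in \<open>auto simp: w_def\<close>)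

lemma isCont_apex:
  assumes "sin (\<alpha> + \<beta>) \<noteq> 0"
  shows "isCont (\<lambda>(x, y). apex x y) (\<alpha>, \<beta>)"
  using assms unfolding apex_def case_prod_beta cis_conv_exp by (intro continuous_intros) auto

lemma apex_near:
  assumes "(\<alpha>, \<beta>, \<gamma>) \<in> triangle_shapes" "\<delta> > 0"
  shows "\<exists>\<epsilon>>0. \<forall>x y. \<bar>\<alpha> - x\<bar> < \<epsilon> \<longrightarrow> \<bar>\<beta> - y\<bar> < \<epsilon> \<longrightarrow>
    x \<in> {0<..<pi} \<and> y \<in> {0<..<pi} \<and> dist (apex x y) (apex \<alpha> \<beta>) < \<delta>"
proof -
  have T: "\<alpha> > 0" "\<beta> > 0" "\<alpha> + \<beta> < pi"
    using assms(1) by (auto simp: triangle_shapes_def)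
  then have "sin (\<alpha> + \<beta>) \<noteq> 0"
    using sin_gt_zero[of "\<alpha> + \<beta>"] by simp
  from isCont_apex[OF this] obtain d where d: "d > 0"
    "\<And>q. dist q (\<alpha>, \<beta>) < d \<Longrightarrow> dist (case q of (x, y) \<Rightarrow> apex x y) (apex \<alpha> \<beta>) < \<delta>"
    unfolding continuous_at_eps_delta using assms(2) by fastforce
  define \<epsilon> where "\<epsilon> = Min {d / 2, \<alpha>, \<beta>, pi - \<alpha>, pi - \<beta>}"
  have \<epsilon>: "\<epsilon> \<le> d / 2" "\<epsilon> \<le> \<alpha>" "\<epsilon> \<le> \<beta>" "\<epsilon> \<le> pi - \<alpha>" "\<epsilon> \<le> pi - \<beta>" "\<epsilon> > 0"
    using d(1) T by (auto simp: \<epsilon>_def)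
  show ?thesis
  proof (intro exI[of _ \<epsilon>] conjI[OF \<open>\<epsilon> > 0\<close>] allI impI)
    fix x y assume xy: "\<bar>\<alpha> - x\<bar> < \<epsilon>" "\<bar>\<beta> - y\<bar> < \<epsilon>"
    have "dist (x, y) (\<alpha>, \<beta>) \<le> dist x \<alpha> + dist y \<beta>"
      unfolding dist_Pair_Pair by (rule sqrt_sum_squares_le_sum) auto
    also have "\<dots> < d"
      using xy \<epsilon>(1) by (simp add: dist_real_def)
    finally have "dist (apex x y) (apex \<alpha> \<beta>) < \<delta>"
      using d(2)[of "(x, y)"] by simp
    then show "x \<in> {0<..<pi} \<and> y \<in> {0<..<pi} \<and> dist (apex x y) (apex \<alpha> \<beta>) < \<delta>"
      using xy \<epsilon> by auto
  qed
qed

text \<open>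
  Comparing the sorted triples amounts to comparing some pairing of their entries, so the shape
  itself can be left unsorted.
\<close>

lemma eps_similar_matching:
  assumes "eps_similar \<epsilon> (x, y, z) (\<alpha>, \<beta>, \<gamma>)"
  obtains x' y' z' where "{#x', y', z'#} = {#x, y, z#}"
    "\<bar>\<alpha> - x'\<bar> < \<epsilon>" "\<bar>\<beta> - y'\<bar> < \<epsilon>" "\<bar>\<gamma> - z'\<bar> < \<epsilon>"
proof -
  have "list_all2 (\<lambda>x y. \<bar>x - y\<bar> < \<epsilon>) (sort [\<alpha>, \<beta>, \<gamma>]) (sort [x, y, z])"
    using assms by (simp add: eps_similar_def)
  from list_all2_reorder_left_invariance[OF this, of "[\<alpha>, \<beta>, \<gamma>]"]
  obtain ys where ys: "list_all2 (\<lambda>x y. \<bar>x - y\<bar> < \<epsilon>) [\<alpha>, \<beta>, \<gamma>] ys" "mset ys = {#x, y, z#}"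
    unfolding mset_sort by auto
  then show thesis
    using that by (auto simp: list_all2_Cons1)
qed

text \<open>
  Every rearrangement of the three angles comes from relabelling the vertices.
\<close>

lemma eps_similar_labelling:
  assumes "eps_similar \<epsilon> (angle_triple a b c) (\<alpha>, \<beta>, \<gamma>)"
  obtains a' b' c' where "{a', b', c'} = {a, b, c}"
    "\<bar>\<alpha> - vertex_angle c' a' b'\<bar> < \<epsilon>" "\<bar>\<beta> - vertex_angle a' b' c'\<bar> < \<epsilon>"
proof -
  obtain x y z where m: "{#x, y, z#} = {#vertex_angle c a b, vertex_angle a b c, vertex_angle b c a#}"
    and near: "\<bar>\<alpha> - x\<bar> < \<epsilon>" "\<bar>\<beta> - y\<bar> < \<epsilon>"
    using eps_similar_matching[OF assms[unfolded angle_triple_def]] by metis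
  let ?A = "vertex_angle c a b" and ?B = "vertex_angle a b c" and ?C = "vertex_angle b c a"
  have "x = ?A \<and> y = ?B \<or> x = ?A \<and> y = ?C \<or> x = ?B \<and> y = ?A \<or> x = ?B \<and> y = ?C \<or>
      x = ?C \<and> y = ?A \<or> x = ?C \<and> y = ?B"
    using m by (auto simp: add_eq_conv_ex)
  then show thesis
    using near that[of a b c] that[of a c b] that[of b a c] that[of b c a] that[of c a b] that[of c b a]
    by (elim disjE) (simp_all add: insert_commute vertex_angle_sym[of b a c] vertex_angle_sym[of c b a]
        vertex_angle_sym[of a c b])
qed

section \<open>The upper bound for generic shapes\<close>

text \<open>
  Every set of at least two points inherits a colouring from the indices, and a triangle that is
  \<open>\<epsilon>\<close>-similar to the given shape has, in a suitable labelling, a ratio within \<open>\<delta>\<close> of the apex or of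
  its conjugate.
\<close>

theorem card_similar_triangles_le:
  assumes T: "(\<alpha>, \<beta>, \<gamma>) \<in> triangle_shapes" and generic: "generic_shape n (apex \<alpha> \<beta>)"
  shows "\<exists>\<epsilon>>0. \<forall>P. finite P \<longrightarrow> card P = n \<longrightarrow>
    24 * int (card (similar_triangles P (\<alpha>, \<beta>, \<gamma>) \<epsilon>)) \<le> int n ^ 3 - int n"
proof -
  define z where "z = apex \<alpha> \<beta>"
  obtain \<delta> where \<delta>: "\<delta> > 0" and colouring:
    "\<forall>p V. inj_on p {..<n} \<longrightarrow> V \<subseteq> {..<n} \<longrightarrow> card V \<ge> 2 \<longrightarrow>
      (\<exists>\<phi> :: nat \<Rightarrow> int. range \<phi> \<subseteq> {0, 1, 2} \<and> \<not> \<phi> constant_on V \<and>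
        (\<forall>a\<in>V. \<forall>b\<in>V. \<forall>c\<in>V. a \<noteq> b \<longrightarrow>
          dist (shape_ratio (p a) (p b) (p c)) z < \<delta> \<or>
          dist (shape_ratio (p a) (p b) (p c)) (cnj z) < \<delta> \<longrightarrow>
          \<phi> a = \<phi> b \<and> \<phi> b = \<phi> c \<or> \<phi> a \<noteq> \<phi> b \<and> \<phi> b \<noteq> \<phi> c \<and> \<phi> a \<noteq> \<phi> c))"
    using generic_colouring[OF generic[folded z_def]] by (elim exE conjE)
  obtain \<epsilon> where \<epsilon>: "\<epsilon> > 0" and near: "\<forall>x y. \<bar>\<alpha> - x\<bar> < \<epsilon> \<longrightarrow> \<bar>\<beta> - y\<bar> < \<epsilon> \<longrightarrow>
    x \<in> {0<..<pi} \<and> y \<in> {0<..<pi} \<and> dist (apex x y) z < \<delta>"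
    using apex_near[OF T \<delta>] unfolding z_def by (elim exE conjE)
  show ?thesis
  proof (intro exI[of _ \<epsilon>] conjI[OF \<epsilon>] allI impI)
    fix P :: "(real^2) set" assume P: "finite P" "card P = n"
    define H where "H = similar_triangles P (\<alpha>, \<beta>, \<gamma>) \<epsilon>"
    obtain f where f: "bij_betw f {..<n} P"
      using ex_bij_betw_nat_finite[OF P(1)] P(2) by (auto simp: lessThan_atLeast0)
    define g where "g = the_inv_into {..<n} f"
    have g: "g v < n" "f (g v) = v" if "v \<in> P" for v
      using that f by (auto simp: g_def bij_betw_def f_the_inv_into_f
          dest: the_inv_into_into[OF _ _ order_refl, of f "{..<n}" v])
    define p where "p = to_complex \<circ> f"
    have "inj_on p {..<n}"
      using f inj_to_complex unfolding p_def bij_betw_def by (intro comp_inj_on) (auto intro: inj_on_subset)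
    have inj_g: "inj_on g P"
      using g(2) by (rule inj_on_inverseI)
    have "24 * int (card {t \<in> H. t \<subseteq> P}) \<le> int (card P) ^ 3 - int (card P)"
    proof (rule card_edges_of_three_colourable[OF P(1)])
      show "card t = 3" if "t \<in> H" for t
        using that by (simp add: H_def similar_triangles_def)
    next
      fix V assume V: "V \<subseteq> P" "card V \<ge> 2"
      have gV: "g ` V \<subseteq> {..<n}"
        using V(1) g(1) by auto
      have "card (g ` V) = card V"
        using inj_g V(1) by (intro card_image) (rule inj_on_subset)
      then have "card (g ` V) \<ge> 2"
        using V(2) by simp
      from colouring[rule_format, OF \<open>inj_on p {..<n}\<close> gV this]
      obtain \<phi> :: "nat \<Rightarrow> int" where \<phi>: "range \<phi> \<subseteq> {0, 1, 2}" "\<not> \<phi> constant_on g ` V"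
        and rainbow: "\<forall>a\<in>g ` V. \<forall>b\<in>g ` V. \<forall>c\<in>g ` V. a \<noteq> b \<longrightarrow>
          dist (shape_ratio (p a) (p b) (p c)) z < \<delta> \<or>
          dist (shape_ratio (p a) (p b) (p c)) (cnj z) < \<delta> \<longrightarrow>
          \<phi> a = \<phi> b \<and> \<phi> b = \<phi> c \<or> \<phi> a \<noteq> \<phi> b \<and> \<phi> b \<noteq> \<phi> c \<and> \<phi> a \<noteq> \<phi> c"
        by (elim exE conjE)
      have "(\<phi> \<circ> g) constant_on t \<or> inj_on (\<phi> \<circ> g) t" if t: "t \<in> H" "t \<subseteq> V" for t
      proof -
        obtain a\<^sub>0 b\<^sub>0 c\<^sub>0 where t0: "t = {a\<^sub>0, b\<^sub>0, c\<^sub>0}" "card t = 3"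
          and sim: "eps_similar \<epsilon> (angle_triple a\<^sub>0 b\<^sub>0 c\<^sub>0) (\<alpha>, \<beta>, \<gamma>)"
          using t(1) unfolding H_def similar_triangles_def by blast
        obtain a b c where abc: "{a, b, c} = {a\<^sub>0, b\<^sub>0, c\<^sub>0}"
          "\<bar>\<alpha> - vertex_angle c a b\<bar> < \<epsilon>" "\<bar>\<beta> - vertex_angle a b c\<bar> < \<epsilon>"
          by (rule eps_similar_labelling[OF sim])
        have t_abc: "t = {a, b, c}"
          using t0(1) abc(1) by simp
        have distinct: "a \<noteq> b" "a \<noteq> c" "b \<noteq> c"
          using t0(2) unfolding t_abc by (auto simp: card_insert_if split: if_splits)
        have V': "a \<in> V" "b \<in> V" "c \<in> V"
          using t(2) t_abc by auto
        define x where "x = vertex_angle c a b"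
        define y where "y = vertex_angle a b c"
        have xy: "x \<in> {0<..<pi}" "y \<in> {0<..<pi}" "dist (apex x y) z < \<delta>"
          using near[rule_format, OF abc(2,3)] by (simp_all add: x_def y_def)
        define w where "w = shape_ratio (to_complex a) (to_complex b) (to_complex c)"
        have "w = apex x y \<or> w = cnj (apex x y)"
          unfolding w_def shape_ratio_def x_def y_def vertex_angle_to_complex
          using distinct xy(1,2) inj_to_complex unfolding x_def y_def vertex_angle_to_complex
          by (intro shape_ratio_eq_apex) (auto dest: injD)
        then have w: "dist w z < \<delta> \<or> dist w (cnj z) < \<delta>"
          using xy(3) by (auto simp: dist_complex_def simp flip: complex_cnj_diff)
        have "p (g v) = to_complex v" if "v \<in> V" for v
          using that V(1) g(2) by (auto simp: p_def)
        then have w': "shape_ratio (p (g a)) (p (g b)) (p (g c)) = w"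
          using V' by (simp add: w_def)
        have "g a \<noteq> g b"
          using inj_g V' V(1) distinct(1) by (auto dest: inj_onD)
        with rainbow V' w have "\<phi> (g a) = \<phi> (g b) \<and> \<phi> (g b) = \<phi> (g c) \<or>
            \<phi> (g a) \<noteq> \<phi> (g b) \<and> \<phi> (g b) \<noteq> \<phi> (g c) \<and> \<phi> (g a) \<noteq> \<phi> (g c)"
          unfolding w'[symmetric] by blast
        then show ?thesis
        proof
          assume "\<phi> (g a) = \<phi> (g b) \<and> \<phi> (g b) = \<phi> (g c)"
          then have "\<forall>v\<in>t. (\<phi> \<circ> g) v = \<phi> (g c)"
            unfolding t_abc by simp
          then show ?thesis
            unfolding constant_on_def by blast
        next
          assume "\<phi> (g a) \<noteq> \<phi> (g b) \<and> \<phi> (g b) \<noteq> \<phi> (g c) \<and> \<phi> (g a) \<noteq> \<phi> (g c)"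
          then have "inj_on (\<phi> \<circ> g) t"
            unfolding t_abc by (auto simp: inj_on_def)
          then show ?thesis ..
        qed
      qed
      moreover have "range (\<phi> \<circ> g) \<subseteq> {0, 1, 2}"
        using \<phi>(1) by auto
      moreover have "\<not> (\<phi> \<circ> g) constant_on V"
        using \<phi>(2) by (auto simp: constant_on_def)
      ultimately show "\<exists>\<phi> :: real^2 \<Rightarrow> int. range \<phi> \<subseteq> {0, 1, 2} \<and> \<not> \<phi> constant_on V \<and>
          (\<forall>t\<in>H. t \<subseteq> V \<longrightarrow> \<phi> constant_on t \<or> inj_on \<phi> t)"
        by blast
    qed
    moreover have "{t \<in> H. t \<subseteq> P} = H"
      by (auto simp: H_def similar_triangles_def)
    ultimately show "24 * int (card (similar_triangles P (\<alpha>, \<beta>, \<gamma>) \<epsilon>)) \<le> int n ^ 3 - int n"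
      by (simp add: H_def P(2))
  qed
qed

section \<open>Almost every shape is generic\<close>

definition poly_fun :: "(complex \<Rightarrow> complex) \<Rightarrow> bool" where
  "poly_fun f \<longleftrightarrow> (\<exists>q. \<forall>x. f x = poly q x)"

lemma poly_fun_const: "poly_fun (\<lambda>_. c)"
  unfolding poly_fun_def by (intro exI[of _ "[:c:]"]) simp

lemma poly_fun_id: "poly_fun (\<lambda>x. x)"
  unfolding poly_fun_def by (intro exI[of _ "[:0, 1:]"]) simp

lemma poly_fun_add: "poly_fun f \<Longrightarrow> poly_fun g \<Longrightarrow> poly_fun (\<lambda>x. f x + g x)"
  unfolding poly_fun_def by (metis poly_add)

lemma poly_fun_diff: "poly_fun f \<Longrightarrow> poly_fun g \<Longrightarrow> poly_fun (\<lambda>x. f x - g x)"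
  unfolding poly_fun_def by (metis poly_diff)

lemma poly_fun_mult: "poly_fun f \<Longrightarrow> poly_fun g \<Longrightarrow> poly_fun (\<lambda>x. f x * g x)"
  unfolding poly_fun_def by (metis poly_mult)

lemma poly_fun_sum: "(\<And>i. i \<in> I \<Longrightarrow> poly_fun (f i)) \<Longrightarrow> poly_fun (\<lambda>x. \<Sum>i\<in>I. f i x)"
  by (induction I rule: infinite_finite_induct) (auto intro: poly_fun_const poly_fun_add)

lemma poly_fun_prod: "(\<And>i. i \<in> I \<Longrightarrow> poly_fun (f i)) \<Longrightarrow> poly_fun (\<lambda>x. \<Prod>i\<in>I. f i x)"
  by (induction I rule: infinite_finite_induct) (auto intro: poly_fun_const poly_fun_mult)

lemmas poly_fun_intros = poly_fun_const poly_fun_id poly_fun_add poly_fun_diff poly_fun_mult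
  poly_fun_sum poly_fun_prod

lemma poly_fun_finite_zeros:
  assumes "poly_fun f" "f c \<noteq> 0"
  shows "finite {x. f x = 0}"
proof -
  obtain q where q: "\<And>x. f x = poly q x"
    using assms(1) unfolding poly_fun_def by blast
  then have "q \<noteq> 0"
    using assms(2) by auto
  then show ?thesis
    unfolding q by (rule poly_roots_finite)
qed

lemma poly_fun_shape_det:
  assumes "poly_fun f" "poly_fun g"
  shows "poly_fun (\<lambda>x. shape_det n E F (f x) (g x))"
proof -
  have weight: "poly_fun (\<lambda>x. shape_weights (f x) (g x) e)" for e
    using assms by (cases "snd (snd (snd e))") (simp_all add: shape_weights_def case_prod_beta)
  have "poly_fun (\<lambda>x. edge_row e (shape_weights (f x) (g x) e) j)" for e j
    using weight[of e] by (cases e rule: prod_cases4) (simp only: edge_row_def prod.case, intro poly_fun_intros)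
  then show ?thesis
    unfolding shape_det_def leibniz_det_def gram_def by (intro poly_fun_intros)
qed

lemma continuous_on_shape_det:
  assumes "continuous_on S f" "continuous_on S g"
  shows "continuous_on S (\<lambda>x. shape_det n E F (f x) (g x))"
proof -
  have weight: "continuous_on S (\<lambda>x. shape_weights (f x) (g x) e)" for e
    using assms by (cases "snd (snd (snd e))") (simp_all add: shape_weights_def case_prod_beta)
  have "continuous_on S (\<lambda>x. edge_row e (shape_weights (f x) (g x) e) j)" for e j
    using weight[of e] by (cases e rule: prod_cases4) (simp only: edge_row_def prod.case, intro continuous_intros)
  then show ?thesis
    unfolding shape_det_def leibniz_det_def gram_def by (intro continuous_intros)
qed

lemma inj_on_cis_double: "inj_on (\<lambda>\<alpha>. cis (2 * \<alpha>)) {0<..<pi}"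
proof (rule inj_onI)
  fix x y assume xy: "x \<in> {0<..<pi}" "y \<in> {0<..<pi}" "cis (2 * x) = cis (2 * y)"
  then have "cis (2 * (x - y)) = 1"
    by (simp add: right_diff_distrib flip: cis_divide)
  then have "cos (2 * (x - y)) = 1"
    by (simp add: complex_eq_iff)
  then have "sin (x - y) = 0"
    unfolding cos_double_sin by simp
  moreover have "\<bar>x - y\<bar> < pi"
    using xy by auto
  ultimately show "x = y"
    using sin_eq_0_pi[of "x - y"] by auto
qed

lemma inj_on_apex: "0 < \<alpha> \<Longrightarrow> inj_on (apex \<alpha>) {0<..<pi - \<alpha>}"
proof (rule inj_onI)
  fix x y assume \<alpha>: "0 < \<alpha>" and xy: "x \<in> {0<..<pi - \<alpha>}" "y \<in> {0<..<pi - \<alpha>}" "apex \<alpha> x = apex \<alpha> y"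
  then have pos: "sin (\<alpha> + x) > 0" "sin (\<alpha> + y) > 0" "sin \<alpha> > 0"
    by (auto intro!: sin_gt_zero)
  have "sin x / sin (\<alpha> + x) = sin y / sin (\<alpha> + y)"
    using xy(3) by (simp add: apex_def flip: of_real_divide)
  then have "sin x * sin (\<alpha> + y) = sin y * sin (\<alpha> + x)"
    using pos by (simp add: field_simps)
  then have "sin \<alpha> * sin (x - y) = 0"
    by (simp add: sin_add sin_diff algebra_simps)
  then have "sin (x - y) = 0"
    using pos by simp
  moreover have "\<bar>x - y\<bar> < pi"
    using xy \<alpha> by auto
  ultimately show "x = y"
    using sin_eq_0_pi[of "x - y"] by auto
qed

text \<open>
  For fixed \<open>\<alpha>\<close> the ratio of the two coefficients is fixed, so that the determinant becomes a
  polynomial in one variable.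
\<close>

lemma apex_eq_cis_cnj: "apex \<alpha> \<beta> = cis (2 * \<alpha>) * cnj (apex \<alpha> \<beta>)"
  by (simp add: apex_def cis_cnj cis_mult flip: mult.assoc)

lemma null_set_of_finite_slices:
  fixes B :: "(real \<times> real) set"
  assumes B: "B \<in> sets borel" and A: "finite A" and slices: "\<And>x. x \<notin> A \<Longrightarrow> finite (Pair x -` B)"
  shows "B \<in> null_sets lborel"
proof -
  have sets: "B \<in> sets (lborel \<Otimes>\<^sub>M lborel)"
    unfolding lborel_prod using B by simp
  have "emeasure lborel B = emeasure (lborel \<Otimes>\<^sub>M lborel) B"
    by (simp add: lborel_prod)
  also have "\<dots> = (\<integral>\<^sup>+ x. emeasure lborel (Pair x -` B) \<partial>lborel)"
    by (rule lborel.emeasure_pair_measure_alt[OF sets])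
  also have "\<dots> = (\<integral>\<^sup>+ x. 0 \<partial>(lborel :: real measure))"
  proof (rule nn_integral_cong_AE)
    have "AE x in lborel. x \<notin> A"
      using A by (intro AE_not_in finite_imp_null_set_lborel)
    then show "AE x in lborel. emeasure lborel (Pair x -` B) = 0"
      by eventually_elim (auto intro!: emeasure_lborel_countable countable_finite slices)
  qed
  finally show ?thesis
    using B by (simp add: null_sets_def)
qed

definition angle_pairs :: "(real \<times> real) set" where
  "angle_pairs = {(\<alpha>, \<beta>). 0 < \<alpha> \<and> 0 < \<beta> \<and> \<alpha> + \<beta> < pi}"

lemma continuous_on_apex: "continuous_on angle_pairs (\<lambda>(\<alpha>, \<beta>). apex \<alpha> \<beta>)"
proof (rule continuous_at_imp_continuous_on, clarify)
  fix \<alpha> \<beta> assume "(\<alpha>, \<beta>) \<in> angle_pairs"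
  then have "sin (\<alpha> + \<beta>) > 0"
    by (intro sin_gt_zero) (auto simp: angle_pairs_def)
  then show "isCont (\<lambda>(\<alpha>, \<beta>). apex \<alpha> \<beta>) (\<alpha>, \<beta>)"
    by (intro isCont_apex) simp
qed

lemma open_angle_pairs: "open angle_pairs"
  unfolding angle_pairs_def case_prod_beta by (intro open_Collect_conj open_Collect_less continuous_intros)

definition singular_pairs :: "nat \<Rightarrow> role set \<Rightarrow> nat set \<Rightarrow> (real \<times> real) set" where
  "singular_pairs n E F =
    {(\<alpha>, \<beta>) \<in> angle_pairs. shape_det n E F (apex \<alpha> \<beta>) (cnj (apex \<alpha> \<beta>)) = 0}"

lemma singular_pairs_borel: "singular_pairs n E F \<in> sets borel"
proof -
  let ?f = "\<lambda>x. shape_det n E F (case x of (\<alpha>, \<beta>) \<Rightarrow> apex \<alpha> \<beta>) (cnj (case x of (\<alpha>, \<beta>) \<Rightarrow> apex \<alpha> \<beta>))"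
  have "continuous_on angle_pairs ?f"
    by (intro continuous_on_shape_det continuous_on_cnj continuous_on_apex)
  then have "open (angle_pairs \<inter> ?f -` (- {0}))"
    by (intro continuous_open_preimage open_angle_pairs) auto
  moreover have "singular_pairs n E F = angle_pairs - (angle_pairs \<inter> ?f -` (- {0}))"
    by (auto simp: singular_pairs_def)
  ultimately show ?thesis
    using open_angle_pairs by auto
qed

text \<open>
  The determinant is a polynomial in the coefficients \<open>s\<close> and \<open>t\<close> that is nonzero at
  \<open>s = t = - 1\<close>. With \<open>s = u * t\<close> and \<open>u = cis (2 * \<alpha>)\<close>, its value at \<open>t = - 1\<close> is a polynomial
  in \<open>u\<close> that is nonzero at \<open>u = 1\<close>; hence for all but finitely many \<open>\<alpha>\<close> it is a nonzero polynomial
  in \<open>t\<close>, which has finitely many roots and so excludes finitely many \<open>\<beta>\<close>.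
\<close>

lemma singular_pairs_null:
  assumes "(E, F) \<in> rigid_patterns n"
  shows "singular_pairs n E F \<in> null_sets lborel"
proof -
  have "shape_weights (- 1) (- 1) = (\<lambda>_. - 1)"
    by (auto simp: shape_weights_def)
  moreover have "leibniz_det n (gram E F (\<lambda>_. - 1 :: complex)) \<noteq> 0"
    using assms of_int_det_gram[of n E F, where 'a = complex] by (simp add: rigid_patterns_def) (metis of_int_eq_0_iff)
  ultimately have nz: "shape_det n E F (- 1) (- 1) \<noteq> 0"
    by (simp add: shape_det_def)
  define A where "A = {\<alpha> \<in> {0<..<pi}. shape_det n E F (- cis (2 * \<alpha>)) (- 1) = 0}"
  have "finite {u. shape_det n E F (- 1 * u) (- 1) = 0}"
    using nz by (intro poly_fun_finite_zeros[where c = 1] poly_fun_shape_det poly_fun_intros) simp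
  moreover have "(\<lambda>\<alpha>. cis (2 * \<alpha>)) ` A \<subseteq> {u. shape_det n E F (- 1 * u) (- 1) = 0}"
    by (auto simp: A_def)
  moreover have "inj_on (\<lambda>\<alpha>. cis (2 * \<alpha>)) A"
    using inj_on_cis_double by (rule inj_on_subset) (auto simp: A_def)
  ultimately have "finite A"
    by (meson finite_subset finite_imageD)
  moreover have "finite (Pair \<alpha> -` singular_pairs n E F)" if "\<alpha> \<notin> A" for \<alpha>
  proof (cases "\<alpha> \<in> {0<..<pi}")
    case False
    then have "Pair \<alpha> -` singular_pairs n E F = {}"
      by (auto simp: singular_pairs_def angle_pairs_def)
    then show ?thesis
      by simp
  next
    case True
    define Z where "Z = {t. shape_det n E F (cis (2 * \<alpha>) * t) t = 0}"
    have "shape_det n E F (cis (2 * \<alpha>) * - 1) (- 1) \<noteq> 0"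
      using that True by (auto simp: A_def)
    then have "finite Z"
      unfolding Z_def by (intro poly_fun_finite_zeros[where c = "- 1"] poly_fun_shape_det poly_fun_intros)
    moreover have "(cnj \<circ> apex \<alpha>) ` (Pair \<alpha> -` singular_pairs n E F) \<subseteq> Z"
      using apex_eq_cis_cnj[of \<alpha>] by (auto simp: Z_def singular_pairs_def)
    moreover have "inj_on (cnj \<circ> apex \<alpha>) (Pair \<alpha> -` singular_pairs n E F)"
    proof (intro comp_inj_on)
      show "inj_on (apex \<alpha>) (Pair \<alpha> -` singular_pairs n E F)"
        by (rule inj_on_subset[OF inj_on_apex]) (use True in \<open>auto simp: singular_pairs_def angle_pairs_def\<close>)
    qed (simp add: inj_on_def)
    ultimately show ?thesis
      by (meson finite_subset finite_imageD)
  qed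
  ultimately show ?thesis
    by (intro null_set_of_finite_slices singular_pairs_borel)
qed

text \<open>
  In the isometric coordinates on the plane of shapes, the first two angles are an affine bijection of
  the plane onto itself, and such maps preserve null sets.
\<close>

lemma null_set_of_shapes:
  assumes B: "B \<in> null_sets lborel"
  shows "{(\<alpha>, \<beta>, \<gamma>). (\<alpha>, \<beta>) \<in> B \<and> \<alpha> + \<beta> + \<gamma> = pi} \<in> null_sets shape_lebesgue"
proof -
  define N :: "(real \<times> real \<times> real) set"
    where "N = {(\<alpha>, \<beta>, \<gamma>). (\<alpha>, \<beta>) \<in> B \<and> \<alpha> + \<beta> + \<gamma> = pi}"
  \<comment> \<open>The inverse of the chart, expressed in the first two angles.\<close>
  define g :: "real \<times> real \<Rightarrow> real \<times> real"
    where "g = (\<lambda>(\<alpha>, \<beta>). ((\<alpha> - \<beta>) / 2 * sqrt 2, (\<alpha> + \<beta> - 2 * pi / 3) / 2 * sqrt 6))"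
  have B': "B \<in> sets borel"
    using B by auto
  have "N = (\<lambda>(\<alpha>, \<beta>, \<gamma>). (\<alpha>, \<beta>)) -` B \<inter> {(\<alpha>, \<beta>, \<gamma>). \<alpha> + \<beta> + \<gamma> = pi}"
    by (auto simp: N_def)
  moreover have "(\<lambda>(\<alpha>, \<beta>, \<gamma>). (\<alpha>, \<beta>)) \<in> borel_measurable (borel :: (real \<times> real \<times> real) measure)"
    unfolding case_prod_beta by (intro borel_measurable_continuous_onI continuous_intros)
  then have "(\<lambda>(\<alpha>, \<beta>, \<gamma>). (\<alpha>, \<beta>)) -` B \<in> sets (borel :: (real \<times> real \<times> real) measure)"
    by (rule measurable_sets_borel[OF _ B'])
  moreover have "closed {(\<alpha>, \<beta>, \<gamma>). \<alpha> + \<beta> + \<gamma> = pi}"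
    unfolding case_prod_beta by (intro closed_Collect_eq continuous_intros)
  ultimately have N: "N \<in> sets borel"
    by (auto intro: borel_closed)
  have "shape_chart -` N = g ` B"
  proof
    show "shape_chart -` N \<subseteq> g ` B"
    proof
      fix q assume q: "q \<in> shape_chart -` N"
      obtain u v where uv: "q = (u, v)"
        by (cases q)
      have qg: "q = g (pi / 3 + u / sqrt 2 + v / sqrt 6, pi / 3 - u / sqrt 2 + v / sqrt 6)"
      proof -
        have "u / sqrt 2 * sqrt 2 = u" "v / sqrt 6 * sqrt 6 = v"
          by simp_all
        then show ?thesis
          by (simp add: g_def uv)
      qed
      have "(pi / 3 + u / sqrt 2 + v / sqrt 6, pi / 3 - u / sqrt 2 + v / sqrt 6) \<in> B"
        using q by (simp add: N_def shape_chart_def uv)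
      then show "q \<in> g ` B"
        by (subst qg) (rule imageI)
    qed
    show "g ` B \<subseteq> shape_chart -` N"
    proof (rule image_subsetI)
      fix x assume "x \<in> B"
      obtain \<alpha> \<beta> where x: "x = (\<alpha>, \<beta>)"
        by (cases x)
      have "shape_chart (g (\<alpha>, \<beta>)) = (\<alpha>, \<beta>, pi - \<alpha> - \<beta>)"
        by (simp add: shape_chart_def g_def field_simps)
      then show "g x \<in> shape_chart -` N"
        using \<open>x \<in> B\<close> by (simp add: N_def x)
    qed
  qed
  moreover have "negligible (g ` B)"
  proof (rule negligible_differentiable_image_negligible)
    show "negligible B"
      using B by (simp add: negligible_iff_null_sets null_sets_completionI)
    show "g differentiable_on B"
      unfolding g_def case_prod_beta differentiable_on_def
      by (intro ballI derivative_intros) (auto intro!: derivative_intros simp: differentiable_def)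
  qed simp
  moreover have "shape_chart -` N \<in> sets lborel"
    using measurable_sets[OF shape_chart_measurable N] by simp
  ultimately have "shape_chart -` N \<in> null_sets lborel"
    using null_sets_completion_iff[of "shape_chart -` N" lborel] negligible_iff_null_sets by auto
  then have "N \<in> null_sets (distr lborel borel shape_chart)"
    using N by (auto simp: null_sets_def emeasure_distr)
  then show ?thesis
    unfolding shape_lebesgue_def N_def by (rule null_sets_completionI)
qed

theorem generic_shape_almost_everywhere:
  "almost_every_triangle (\<lambda>(\<alpha>, \<beta>, \<gamma>). generic_shape n (apex \<alpha> \<beta>))"
proof -
  define B where "B = (\<Union>(E, F)\<in>rigid_patterns n. singular_pairs n E F)"
  define S' where "S' = {(\<alpha>, \<beta>, \<gamma> :: real). (\<alpha>, \<beta>) \<in> B \<and> \<alpha> + \<beta> + \<gamma> = pi}"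
  have "B \<in> null_sets lborel"
    unfolding B_def
    by (intro null_sets_UN' countable_finite finite_rigid_patterns) (auto simp: singular_pairs_null)
  then have "S' \<in> null_sets shape_lebesgue"
    unfolding S'_def by (rule null_set_of_shapes)
  moreover have "S' \<subseteq> triangle_shapes"
    unfolding S'_def B_def singular_pairs_def angle_pairs_def triangle_shapes_def by auto
  moreover have "generic_shape n (apex \<alpha> \<beta>)" if T: "(\<alpha>, \<beta>, \<gamma>) \<in> triangle_shapes - S'" for \<alpha> \<beta> \<gamma>
  proof -
    have pair: "(\<alpha>, \<beta>) \<in> angle_pairs" "(\<alpha>, \<beta>) \<notin> B"
      using T by (auto simp: triangle_shapes_def angle_pairs_def S'_def)
    have "shape_det n E F (apex \<alpha> \<beta>) (cnj (apex \<alpha> \<beta>)) \<noteq> 0" if "(E, F) \<in> rigid_patterns n" for E F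
    proof -
      have "(\<alpha>, \<beta>) \<notin> singular_pairs n E F"
        using that pair(2) unfolding B_def by blast
      then show ?thesis
        using pair(1) by (simp add: singular_pairs_def)
    qed
    then show ?thesis
      unfolding generic_shape_def by blast
  qed
  ultimately show ?thesis
    unfolding almost_every_triangle_def by (intro exI[of _ S'] conjI ballI) auto
qed

section \<open>Many similar triangles among a power of three points\<close>

lemma eps_similarI:
  assumes "\<bar>x - \<alpha>\<bar> < \<epsilon>" "\<bar>y - \<beta>\<bar> < \<epsilon>" "\<bar>z - \<gamma>\<bar> < \<epsilon>"
  shows "eps_similar \<epsilon> (x, y, z) (\<alpha>, \<beta>, \<gamma>)"
  using assms unfolding eps_similar_def by (auto simp: abs_less_iff)

lemma angle_at_eq_arccos_cos: "angle_at a b c = arccos (cos (angle_at a b c))"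
  unfolding cos_angle_at by (simp add: angle_at_def)

lemma angle_at_eqI:
  fixes a b c :: complex
  assumes "(c - a) / (b - a) = of_real r * cis \<theta>" "r > 0" "\<bar>\<theta>\<bar> \<le> pi" "b \<noteq> a"
  shows "angle_at c a b = \<bar>\<theta>\<bar>"
proof -
  have "cos (angle_at c a b) = cos \<theta>"
    using assms by (subst cos_angle_at_ratio) (simp_all add: norm_mult)
  then show ?thesis
    using assms(3) angle_at_eq_arccos_cos[of c a b] arccos_cos_eq_abs by metis
qed

lemma one_minus_apex:
  assumes "sin (\<alpha> + \<beta>) \<noteq> 0"
  shows "1 - apex \<alpha> \<beta> = of_real (sin \<alpha> / sin (\<alpha> + \<beta>)) * cis (- \<beta>)"
  using assms by (auto simp: apex_def complex_eq_iff field_simps sin_add)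

lemma exists_triangle:
  assumes "(\<alpha>, \<beta>, \<gamma>) \<in> triangle_shapes"
  obtains a b c where "a \<noteq> b" "a \<noteq> c" "b \<noteq> c" "angle_triple a b c = (\<alpha>, \<beta>, \<gamma>)"
proof -
  have T: "\<alpha> > 0" "\<beta> > 0" "\<gamma> > 0" "\<gamma> = pi - (\<alpha> + \<beta>)"
    using assms by (auto simp: triangle_shapes_def)
  then have pos: "sin (\<alpha> + \<beta>) > 0" "sin \<alpha> > 0" "sin \<beta> > 0"
    by (auto intro!: sin_gt_zero)
  define z where "z = apex \<alpha> \<beta>"
  define a :: "real^2" where "a = 0"
  define b :: "real^2" where "b = vector [1, 0]"
  define c :: "real^2" where "c = vector [Re z, Im z]"
  have abc: "to_complex a = 0" "to_complex b = 1" "to_complex c = z"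
    by (simp_all add: to_complex_def a_def b_def c_def complex_eq_iff)
  have "Im z > 0"
    using pos by (simp add: z_def apex_def)
  then have z: "z \<noteq> 0" "z \<noteq> 1"
    by auto
  have z1: "1 - z = of_real (sin \<alpha> / sin (\<alpha> + \<beta>)) * cis (- \<beta>)"
    using pos unfolding z_def by (intro one_minus_apex) simp
  have "angle_at z 0 1 = \<bar>\<alpha>\<bar>"
    by (rule angle_at_eqI[where r = "sin \<beta> / sin (\<alpha> + \<beta>)"]) (use T pos in \<open>auto simp: z_def apex_def\<close>)
  moreover have "angle_at z 1 0 = \<bar>- \<beta>\<bar>"
  proof (rule angle_at_eqI[where r = "sin \<alpha> / sin (\<alpha> + \<beta>)"])
    show "(z - 1) / (0 - 1) = of_real (sin \<alpha> / sin (\<alpha> + \<beta>)) * cis (- \<beta>)"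
      using z1 by (simp add: field_simps)
  qed (use T pos in auto)
  moreover have "angle_at 1 z 0 = \<bar>\<gamma>\<bar>"
  proof (rule angle_at_eqI[where r = "sin \<alpha> / sin \<beta>"])
    have "cis \<gamma> * cis \<alpha> = cis (pi - \<beta>)"
      unfolding cis_mult T(4) by simp
    also have "\<dots> = - cis (- \<beta>)"
      by (simp add: complex_eq_iff)
    finally have "of_real (sin \<alpha> / sin \<beta> * (sin \<beta> / sin (\<alpha> + \<beta>))) * - (cis \<gamma> * cis \<alpha>) =
        of_real (sin \<alpha> / sin (\<alpha> + \<beta>)) * cis (- \<beta>)"
      using pos by simp
    then have eq: "of_real (sin \<alpha> / sin \<beta>) * cis \<gamma> * - z = of_real (sin \<alpha> / sin (\<alpha> + \<beta>)) * cis (- \<beta>)"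
      unfolding z_def apex_def of_real_mult by (simp only: mult_minus_right mult.assoc mult.left_commute)
    show "(1 - z) / (0 - z) = of_real (sin \<alpha> / sin \<beta>) * cis \<gamma>"
      unfolding z1 eq[symmetric] using z by simp
  qed (use T pos z in auto)
  ultimately have "angle_triple a b c = (\<alpha>, \<beta>, \<gamma>)"
    using T unfolding angle_triple_def vertex_angle_to_complex abc
    by (auto simp: angle_at_def inner_commute mult.commute)
  moreover have "a \<noteq> b" "a \<noteq> c" "b \<noteq> c"
    using z abc by auto
  ultimately show thesis
    using that by blast
qed

lemma not_collinear_angle:
  assumes "a \<noteq> b" "c \<noteq> b" "vertex_angle a b c \<in> {0<..<pi}"
  shows "\<not> collinear {a, b, c}"
proof
  assume "collinear {a, b, c}"
  then have "\<bar>(a - b) \<bullet> (c - b)\<bar> = norm (a - b) * norm (c - b)"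
    unfolding norm_cauchy_schwarz_equal using collinear_3[of a b c] by simp
  then have "\<bar>cos (vertex_angle a b c)\<bar> = 1"
    using assms(1,2) by (simp add: vertex_angle_def cos_angle_at flip: angle_at_def)
  moreover have "cos pi < cos (vertex_angle a b c)" "cos (vertex_angle a b c) < cos 0"
    using assms(3) by (intro cos_monotone_0_pi; simp)+
  ultimately show False
    by simp
qed

lemma tendsto_vertex_angle:
  assumes lim: "(f \<longlongrightarrow> a) F" "(g \<longlongrightarrow> b) F" "(k \<longlongrightarrow> c) F"
    and "a \<noteq> b" "c \<noteq> b" "vertex_angle a b c \<in> {0<..<pi}"
  shows "((\<lambda>x. vertex_angle (f x) (g x) (k x)) \<longlongrightarrow> vertex_angle a b c) F"
  unfolding vertex_angle_def
proof (rule isCont_tendsto_compose[OF isCont_arccos])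
  have "cos pi < cos (vertex_angle a b c)" "cos (vertex_angle a b c) < cos 0"
    using assms(6) by (intro cos_monotone_0_pi; simp)+
  then show "- 1 < (a - b) \<bullet> (c - b) / (norm (a - b) * norm (c - b))"
    "(a - b) \<bullet> (c - b) / (norm (a - b) * norm (c - b)) < 1"
    by (simp_all add: vertex_angle_def cos_angle_at flip: angle_at_def)
  show "((\<lambda>x. (f x - g x) \<bullet> (k x - g x) / (norm (f x - g x) * norm (k x - g x))) \<longlongrightarrow>
      (a - b) \<bullet> (c - b) / (norm (a - b) * norm (c - b))) F"
    using assms by (intro tendsto_intros) auto
qed

lemma not_collinear_distinct:
  assumes "\<not> collinear {a, b, c}"
  shows "a \<noteq> b" "a \<noteq> c" "b \<noteq> c"
  using assms collinear_2 by (auto simp: insert_commute)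

lemma similar_trianglesI:
  assumes "a \<in> P" "b \<in> P" "c \<in> P" "\<not> collinear {a, b, c}" "eps_similar \<epsilon> (angle_triple a b c) T"
  shows "{a, b, c} \<in> similar_triangles P T \<epsilon>"
proof -
  have "card {a, b, c} = 3"
    using not_collinear_distinct[OF assms(4)] by simp
  then show ?thesis
    using assms unfolding similar_triangles_def by blast
qed

text \<open>
  A triangle that is not degenerate stays so, and keeps its angles up to \<open>\<epsilon>\<close>, under small perturbations
  of its vertices.
\<close>

lemma eventually_similar:
  fixes a b c x y z :: "real^2"
  assumes T: "(\<alpha>, \<beta>, \<gamma>) \<in> triangle_shapes" and abc: "a \<noteq> b" "a \<noteq> c" "b \<noteq> c"
    and angles: "angle_triple a b c = (\<alpha>, \<beta>, \<gamma>)" and "\<epsilon> > 0"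
  shows "\<forall>\<^sub>F d in at_right 0. \<not> collinear {a + d *\<^sub>R x, b + d *\<^sub>R y, c + d *\<^sub>R z} \<and>
    eps_similar \<epsilon> (angle_triple (a + d *\<^sub>R x) (b + d *\<^sub>R y) (c + d *\<^sub>R z)) (\<alpha>, \<beta>, \<gamma>)"
proof -
  have range: "\<alpha> \<in> {0<..<pi}" "\<beta> \<in> {0<..<pi}" "\<gamma> \<in> {0<..<pi}"
    using T by (auto simp: triangle_shapes_def)
  have ang: "vertex_angle c a b = \<alpha>" "vertex_angle a b c = \<beta>" "vertex_angle b c a = \<gamma>"
    using angles by (auto simp: angle_triple_def)
  have lim: "((\<lambda>d. v + d *\<^sub>R w) \<longlongrightarrow> v) (at_right 0)" for v w :: "real^2"
    by (rule tendsto_eq_intros refl | simp)+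
  have lims: "((\<lambda>d. vertex_angle (c + d *\<^sub>R z) (a + d *\<^sub>R x) (b + d *\<^sub>R y)) \<longlongrightarrow> \<alpha>) (at_right 0)"
    "((\<lambda>d. vertex_angle (a + d *\<^sub>R x) (b + d *\<^sub>R y) (c + d *\<^sub>R z)) \<longlongrightarrow> \<beta>) (at_right 0)"
    "((\<lambda>d. vertex_angle (b + d *\<^sub>R y) (c + d *\<^sub>R z) (a + d *\<^sub>R x)) \<longlongrightarrow> \<gamma>) (at_right 0)"
    using tendsto_vertex_angle[OF lim lim lim, of c a b z x y]
      tendsto_vertex_angle[OF lim lim lim, of a b c x y z]
      tendsto_vertex_angle[OF lim lim lim, of b c a y z x] abc range
    unfolding ang by auto
  have near: "\<forall>\<^sub>F d in at_right 0. \<bar>vertex_angle (c + d *\<^sub>R z) (a + d *\<^sub>R x) (b + d *\<^sub>R y) - \<alpha>\<bar> < \<epsilon>"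
    "\<forall>\<^sub>F d in at_right 0. \<bar>vertex_angle (a + d *\<^sub>R x) (b + d *\<^sub>R y) (c + d *\<^sub>R z) - \<beta>\<bar> < \<epsilon>"
    "\<forall>\<^sub>F d in at_right 0. \<bar>vertex_angle (b + d *\<^sub>R y) (c + d *\<^sub>R z) (a + d *\<^sub>R x) - \<gamma>\<bar> < \<epsilon>"
    using lims \<open>\<epsilon> > 0\<close> by (auto dest!: tendstoD simp: dist_real_def)
  have "\<forall>\<^sub>F d in at_right 0. vertex_angle (a + d *\<^sub>R x) (b + d *\<^sub>R y) (c + d *\<^sub>R z) \<in> {0<..<pi}"
    using lims(2) range(2) by (intro topological_tendstoD) auto
  moreover have "\<forall>\<^sub>F d in at_right 0. (a + d *\<^sub>R x) - (b + d *\<^sub>R y) \<noteq> 0"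
    using abc by (intro tendsto_imp_eventually_ne[OF tendsto_diff[OF lim lim]]) simp
  moreover have "\<forall>\<^sub>F d in at_right 0. (c + d *\<^sub>R z) - (b + d *\<^sub>R y) \<noteq> 0"
    using abc by (intro tendsto_imp_eventually_ne[OF tendsto_diff[OF lim lim]]) simp
  ultimately show ?thesis
    using near
  proof eventually_elim
    case (elim d)
    then show ?case
      unfolding angle_triple_def by (intro conjI not_collinear_angle eps_similarI) auto
  qed
qed

lemma collinear_3_inner:
  "collinear {a, b, c} \<longleftrightarrow> \<bar>(a - b) \<bullet> (c - b)\<bar> = norm (a - b) * norm (c - b)"
  unfolding norm_cauchy_schwarz_equal by (rule collinear_3) (simp add: NO_MATCH_def)

lemma card_similar_triangles_homothety:
  fixes v :: "real^2"
  assumes "finite P" "d > 0"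
  shows "card (similar_triangles P T \<epsilon>) \<le> card (similar_triangles ((\<lambda>x. v + d *\<^sub>R x) ` P) T \<epsilon>)"
proof (rule card_inj_on_le)
  let ?f = "\<lambda>x. v + d *\<^sub>R x"
  have inj: "inj ?f"
    using assms(2) by (auto intro: injI)
  show "inj_on (image ?f) (similar_triangles P T \<epsilon>)"
    using inj by (auto intro!: inj_onI simp: inj_image_eq_iff)
  have diff: "?f x - ?f y = d *\<^sub>R (x - y)" for x y
    by (simp add: scaleR_diff_right)
  have angle: "vertex_angle (?f a) (?f b) (?f c) = vertex_angle a b c" for a b c
    unfolding vertex_angle_def diff using assms(2) by simp
  have collinear: "collinear {?f a, ?f b, ?f c} \<longleftrightarrow> collinear {a, b, c}" for a b c
    unfolding collinear_3_inner diff using assms(2) by (simp add: abs_mult)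
  show "image ?f ` similar_triangles P T \<epsilon> \<subseteq> similar_triangles (?f ` P) T \<epsilon>"
  proof clarify
    fix t assume t: "t \<in> similar_triangles P T \<epsilon>"
    then obtain a b c where abc: "t = {a, b, c}" "eps_similar \<epsilon> (angle_triple a b c) T"
      unfolding similar_triangles_def by blast
    have "?f ` t = {?f a, ?f b, ?f c}"
      by (simp add: abc(1))
    also have "\<dots> \<in> similar_triangles (?f ` P) T \<epsilon>"
    proof (rule similar_trianglesI)
      show "\<not> collinear {?f a, ?f b, ?f c}"
        using t unfolding collinear by (simp add: similar_triangles_def abc(1))
      show "eps_similar \<epsilon> (angle_triple (?f a) (?f b) (?f c)) T"
        using abc(2) by (simp add: angle_triple_def angle)
    qed (use t in \<open>auto simp: similar_triangles_def abc(1)\<close>)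
    finally show "?f ` t \<in> similar_triangles (?f ` P) T \<epsilon>" .
  qed
  show "finite (similar_triangles (?f ` P) T \<epsilon>)"
    by (rule finite_subset[of _ "Pow (?f ` P)"]) (use assms(1) in \<open>auto simp: similar_triangles_def\<close>)
qed

lemma card_similar_triangles_union:
  fixes A B C :: "(real^2) set"
  assumes fin: "finite A" "finite B" "finite C"
    and disj: "A \<inter> B = {}" "A \<inter> C = {}" "B \<inter> C = {}"
    and transversal: "\<And>x y z. x \<in> A \<Longrightarrow> y \<in> B \<Longrightarrow> z \<in> C \<Longrightarrow> {x, y, z} \<in> similar_triangles (A \<union> B \<union> C) T \<epsilon>"
  shows "card A * card B * card C + card (similar_triangles A T \<epsilon>) + card (similar_triangles B T \<epsilon>) +
    card (similar_triangles C T \<epsilon>) \<le> card (similar_triangles (A \<union> B \<union> C) T \<epsilon>)"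
proof -
  let ?S = "\<lambda>P. similar_triangles P T \<epsilon>"
  define X where "X = (\<lambda>(x, y, z). {x, y, z}) ` (A \<times> B \<times> C)"
  have finS: "finite (?S P)" if "finite P" for P
    by (rule finite_subset[of _ "Pow P"]) (use that in \<open>auto simp: similar_triangles_def\<close>)
  have "inj_on (\<lambda>(x, y, z). {x, y, z}) (A \<times> B \<times> C)"
  proof (rule inj_onI)
    fix p q
    assume "p \<in> A \<times> B \<times> C" "q \<in> A \<times> B \<times> C" "(case p of (x, y, z) \<Rightarrow> {x, y, z}) = (case q of (x, y, z) \<Rightarrow> {x, y, z})"
    then obtain x y z x' y' z' where pq: "p = (x, y, z)" "q = (x', y', z')" and m: "x \<in> A" "y \<in> B" "z \<in> C" "x' \<in> A" "y' \<in> B" "z' \<in> C" and eq: "{x, y, z} = {x', y', z'}"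
      by (cases p rule: prod_cases3; cases q rule: prod_cases3) simp
    have "{x} = {x, y, z} \<inter> A" "{y} = {x, y, z} \<inter> B" "{z} = {x, y, z} \<inter> C"
      using m disj by auto
    moreover have "{x'} = {x', y', z'} \<inter> A" "{y'} = {x', y', z'} \<inter> B" "{z'} = {x', y', z'} \<inter> C"
      using m disj by auto
    ultimately have "{x} = {x'}" "{y} = {y'}" "{z} = {z'}"
      unfolding eq by simp_all
    then show "p = q"
      by (simp add: pq)
  qed
  then have card_X: "card X = card A * card B * card C"
    unfolding X_def by (simp add: card_image card_cartesian_product mult.assoc)
  have nonempty: "t \<noteq> {}" if "t \<in> ?S P" for t P
    using that by (auto simp: similar_triangles_def)
  have sub: "t \<subseteq> P" if "t \<in> ?S P" for t P
    using that by (simp add: similar_triangles_def)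
  have X_disj: "X \<inter> ?S A = {}" "X \<inter> ?S B = {}" "X \<inter> ?S C = {}"
    using disj sub unfolding X_def by fast+
  have S_disj: "?S P \<inter> ?S Q = {}" if "P \<inter> Q = {}" for P Q
    using that sub[of _ P] sub[of _ Q] nonempty[of _ P] by fast
  have finX: "finite X"
    using fin by (simp add: X_def)
  have "card A * card B * card C + card (?S A) + card (?S B) + card (?S C) =
      card (((X \<union> ?S A) \<union> ?S B) \<union> ?S C)"
  proof -
    have "((X \<union> ?S A) \<union> ?S B) \<inter> ?S C = {}" "(X \<union> ?S A) \<inter> ?S B = {}"
      using X_disj S_disj[OF disj(1)] S_disj[OF disj(2)] S_disj[OF disj(3)] by blast+
    then show ?thesis
      using finX finS[OF fin(1)] finS[OF fin(2)] finS[OF fin(3)] X_disj(1)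
      by (simp only: card_Un_disjoint finite_UnI card_X)
  qed
  also have "\<dots> \<le> card (?S (A \<union> B \<union> C))"
  proof (rule card_mono)
    show "finite (?S (A \<union> B \<union> C))"
      using fin by (intro finS) simp
    have mono: "?S P \<subseteq> ?S Q" if "P \<subseteq> Q" for P Q
      using that unfolding similar_triangles_def by blast
    have "X \<subseteq> ?S (A \<union> B \<union> C)"
      using transversal by (auto simp: X_def)
    then show "((X \<union> ?S A) \<union> ?S B) \<union> ?S C \<subseteq> ?S (A \<union> B \<union> C)"
      using mono[of A "A \<union> B \<union> C"] mono[of B "A \<union> B \<union> C"] mono[of C "A \<union> B \<union> C"] by blast
  qed
  finally show ?thesis .
qed

text \<open>
  Replacing each vertex of an exact copy of the shape by a tiny homothetic copy of a good set \<open>P\<close> of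
  \<open>m\<close> points gives \<open>3 * m\<close> points, and adds \<open>m ^ 3\<close> transversal triangles to three times the number
  of triangles in \<open>P\<close>. This makes the bound for three equal classes an equality at every level.
\<close>

theorem exists_many_similar_triangles:
  assumes T: "(\<alpha>, \<beta>, \<gamma>) \<in> triangle_shapes" and \<epsilon>: "\<epsilon> > 0"
  shows "\<exists>P. finite P \<and> card P = 3 ^ k \<and>
    int (3 ^ k) ^ 3 - int (3 ^ k) \<le> 24 * int (card (similar_triangles P (\<alpha>, \<beta>, \<gamma>) \<epsilon>))"
proof (induction k)
  case 0
  show ?case
    by (intro exI[of _ "{0}"]) simp
next
  case (Suc k)
  define m where "m = (3 ^ k :: nat)"
  let ?S = "\<lambda>P. similar_triangles P (\<alpha>, \<beta>, \<gamma>) \<epsilon>"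
  obtain P where P: "finite P" "card P = m" "int m ^ 3 - int m \<le> 24 * int (card (?S P))"
    using Suc.IH unfolding m_def by blast
  have "P \<noteq> {}"
    using P(2) by (auto simp: m_def)
  obtain a b c where abc: "a \<noteq> b" "a \<noteq> c" "b \<noteq> c" "angle_triple a b c = (\<alpha>, \<beta>, \<gamma>)"
    using exists_triangle[OF T] by blast
  have "\<forall>\<^sub>F d in at_right 0. \<forall>x\<in>P. \<forall>y\<in>P. \<forall>z\<in>P.
      \<not> collinear {a + d *\<^sub>R x, b + d *\<^sub>R y, c + d *\<^sub>R z} \<and>
      eps_similar \<epsilon> (angle_triple (a + d *\<^sub>R x) (b + d *\<^sub>R y) (c + d *\<^sub>R z)) (\<alpha>, \<beta>, \<gamma>)"
    using P(1) by (intro eventually_ball_finite ballI eventually_similar[OF T abc \<epsilon>])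
  moreover have "\<forall>\<^sub>F d :: real in at_right 0. d > 0"
    by (rule eventually_at_right_less)
  ultimately have "\<forall>\<^sub>F d :: real in at_right 0. d > 0 \<and> (\<forall>x\<in>P. \<forall>y\<in>P. \<forall>z\<in>P.
      \<not> collinear {a + d *\<^sub>R x, b + d *\<^sub>R y, c + d *\<^sub>R z} \<and>
      eps_similar \<epsilon> (angle_triple (a + d *\<^sub>R x) (b + d *\<^sub>R y) (c + d *\<^sub>R z)) (\<alpha>, \<beta>, \<gamma>))"
    by (simp add: eventually_conj_iff)
  from eventually_happens'[OF _ this] obtain d :: real where d: "d > 0"
    and good: "\<forall>x\<in>P. \<forall>y\<in>P. \<forall>z\<in>P. \<not> collinear {a + d *\<^sub>R x, b + d *\<^sub>R y, c + d *\<^sub>R z} \<and>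
      eps_similar \<epsilon> (angle_triple (a + d *\<^sub>R x) (b + d *\<^sub>R y) (c + d *\<^sub>R z)) (\<alpha>, \<beta>, \<gamma>)"
    using trivial_limit_at_right_real by auto
  define A where "A = (\<lambda>x. a + d *\<^sub>R x) ` P"
  define B where "B = (\<lambda>x. b + d *\<^sub>R x) ` P"
  define C where "C = (\<lambda>x. c + d *\<^sub>R x) ` P"
  have fin: "finite A" "finite B" "finite C"
    using P(1) by (simp_all add: A_def B_def C_def)
  have card: "card A = m" "card B = m" "card C = m"
    using d P(2) by (simp_all add: A_def B_def C_def card_image inj_on_def)
  have good': "\<not> collinear {x, y, z}" "eps_similar \<epsilon> (angle_triple x y z) (\<alpha>, \<beta>, \<gamma>)"
    if "x \<in> A" "y \<in> B" "z \<in> C" for x y z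
    using good that by (auto simp: A_def B_def C_def)
  have nonempty: "A \<noteq> {}" "B \<noteq> {}" "C \<noteq> {}"
    using \<open>P \<noteq> {}\<close> by (simp_all add: A_def B_def C_def)
  have disj: "A \<inter> B = {}" "A \<inter> C = {}" "B \<inter> C = {}"
    using not_collinear_distinct[OF good'(1)] nonempty by blast+
  have "card A * card B * card C + card (?S A) + card (?S B) + card (?S C) \<le> card (?S (A \<union> B \<union> C))"
    using good' by (intro card_similar_triangles_union fin disj similar_trianglesI) auto
  moreover have "card (?S P) \<le> card (?S A)" "card (?S P) \<le> card (?S B)" "card (?S P) \<le> card (?S C)"
    unfolding A_def B_def C_def by (intro card_similar_triangles_homothety P d)+
  ultimately have "m * m * m + 3 * card (?S P) \<le> card (?S (A \<union> B \<union> C))"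
    using card by simp
  then have "24 * (int m * int m * int m) + 3 * (24 * int (card (?S P))) \<le> 24 * int (card (?S (A \<union> B \<union> C)))"
    by (simp flip: of_nat_mult of_nat_add)
  moreover have "int (3 ^ Suc k) ^ 3 - int (3 ^ Suc k) = 24 * (int m * int m * int m) + 3 * (int m ^ 3 - int m)"
    by (simp add: m_def power3_eq_cube)
  moreover have "card (A \<union> B \<union> C) = 3 ^ Suc k"
    using fin disj card by (simp add: card_Un_disjoint Int_Un_distrib2 m_def)
  ultimately show ?case
    using P(3) fin by (intro exI[of _ "A \<union> B \<union> C"]) auto
qed

section \<open>The maximum for powers of three\<close>

theorem corollary1p5:
  fixes n :: nat
  assumes "\<exists>k::nat. n = 3 ^ k"
  shows "almost_every_triangle
           (\<lambda>T. \<exists>\<epsilon>>0. real (h n T \<epsilon>) = 1 / 24 * (real n ^ 3 - real n))"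
proof -
  obtain k where n: "n = 3 ^ k"
    using assms by blast
  have exact: "\<exists>\<epsilon>>0. real (h n (\<alpha>, \<beta>, \<gamma>) \<epsilon>) = 1 / 24 * (real n ^ 3 - real n)"
    if T: "(\<alpha>, \<beta>, \<gamma>) \<in> triangle_shapes" and generic: "generic_shape n (apex \<alpha> \<beta>)" for \<alpha> \<beta> \<gamma>
  proof -
    obtain \<epsilon> where \<epsilon>: "\<epsilon> > 0" and upper: "\<forall>P. finite P \<longrightarrow> card P = n \<longrightarrow>
        24 * int (card (similar_triangles P (\<alpha>, \<beta>, \<gamma>) \<epsilon>)) \<le> int n ^ 3 - int n"
      using card_similar_triangles_le[OF T generic] by (elim exE conjE)
    let ?H = "{card (similar_triangles P (\<alpha>, \<beta>, \<gamma>) \<epsilon>) | P. finite P \<and> card P = n}"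
    have "h n (\<alpha>, \<beta>, \<gamma>) \<epsilon> \<in> ?H"
      unfolding h_def by (rule Max_in[OF h_values_finite h_values_nonempty])
    then have "24 * int (h n (\<alpha>, \<beta>, \<gamma>) \<epsilon>) \<le> int n ^ 3 - int n"
      using upper by auto
    moreover obtain P where P: "finite P" "card P = n"
      "int n ^ 3 - int n \<le> 24 * int (card (similar_triangles P (\<alpha>, \<beta>, \<gamma>) \<epsilon>))"
      using exists_many_similar_triangles[OF T \<epsilon>, of k] unfolding n by blast
    have "card (similar_triangles P (\<alpha>, \<beta>, \<gamma>) \<epsilon>) \<le> h n (\<alpha>, \<beta>, \<gamma>) \<epsilon>"
      unfolding h_def by (rule Max_ge[OF h_values_finite]) (use P in blast)
    ultimately have "24 * int (h n (\<alpha>, \<beta>, \<gamma>) \<epsilon>) = int n ^ 3 - int n"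
      using P(3) by linarith
    then have "real_of_int (24 * int (h n (\<alpha>, \<beta>, \<gamma>) \<epsilon>)) = real_of_int (int n ^ 3 - int n)"
      by (rule arg_cong)
    then have "real (h n (\<alpha>, \<beta>, \<gamma>) \<epsilon>) = 1 / 24 * (real n ^ 3 - real n)"
      by simp
    with \<epsilon> show ?thesis
      by blast
  qed
  obtain S' where S': "S' \<subseteq> triangle_shapes" "S' \<in> null_sets shape_lebesgue"
    and generic: "\<forall>T \<in> triangle_shapes - S'. case T of (\<alpha>, \<beta>, \<gamma>) \<Rightarrow> generic_shape n (apex \<alpha> \<beta>)"
    using generic_shape_almost_everywhere[of n] unfolding almost_every_triangle_def
    by (elim exE conjE)
  show ?thesis
    unfolding almost_every_triangle_def
  proof (intro exI[of _ S'] conjI S' ballI)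
    fix T assume T: "T \<in> triangle_shapes - S'"
    obtain \<alpha> \<beta> \<gamma> where shape: "T = (\<alpha>, \<beta>, \<gamma>)"
      by (cases T rule: prod_cases3)
    then have "(\<alpha>, \<beta>, \<gamma>) \<in> triangle_shapes" "generic_shape n (apex \<alpha> \<beta>)"
      using T bspec[OF generic T] by simp_all
    then show "\<exists>\<epsilon>>0. real (h n T \<epsilon>) = 1 / 24 * (real n ^ 3 - real n)"
      unfolding shape by (rule exact)
  qed
qed

end
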